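(* Let $F:\mathbb{R}_+\to\mathbb{R}$ be measurable, positive and locally bounded. Let $\alpha>-1$, $\rho\in(-1-\alpha,0)$ and $A\in\mathscr{A}^\infty_\rho$. Write $\hat F(1/\cdot)$ for the function $\lambda\mapsto\hat F(1/\lambda)$, $\lambda>0$. The following hold. (1) If $F\in\mathrm{2RV}^\infty_{\alpha,\rho}(A)$, then $\hat F(1/\cdot)\in\mathrm{2RV}^\infty_{\alpha,\rho}\Big(\frac{\Gamma(\alpha+\rho+1)}{\Gamma(\alpha+1)}\cdot A\Big)$. (2) If $F\in\mathscr{M}^\infty_{\alpha,-}$ and $\hat F(1/\cdot)\in\mathrm{2RV}^\infty_{\alpha,\rho}\Big(\frac{\Gamma(\alpha+\rho+1)}{\Gamma(\alpha+1)}\cdot A\Big)$, then $F\in\mathrm{2RV}^\infty_{\alpha,\rho}(A)$.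
   Context: A measurable function $F$ (defined on $\mathbb{R}_+$ or $(0,\infty)$) is regularly varying at infinity with index $\alpha\in\mathbb{R}$, written $F\in\mathrm{RV}^\infty_\alpha$, if it has constant sign near infinity and $\lim_{t\to\infty}F(tx)/F(t)=x^\alpha$ for every $x>0$. A function $F\in\mathrm{RV}^\infty_\alpha$ belongs to $\mathrm{2RV}^\infty_{\alpha,\rho}(A)$ (where $A$ is an eventually positive or eventually negative function) if for every $x>0$ $$\lim_{t\to\infty}\frac{F(tx)/F(t)-x^\alpha}{A(t)}=x^\alpha\int_1^x u^{\rho-1}\,du .$$ For $\rho\le 0$, $\mathscr{A}^\infty_\rho:=\{A\in\mathrm{RV}^\infty_\rho:\lim_{t\to\infty}A(t)=0\}$. The Laplace–Stieltjes transform of a locally integrable $F$ is $\hat F(\lambda):=\int_0^\infty\lambda e^{-\lambda t}F(t)\,dt$, $\lambda>0$. For $\alpha\in\mathbb{R}$, $\mathscr{M}^\infty_{\alpha,-}$ is the set of functions $F:\mathbb{R}_+\to\mathbb{R}$ that are locally bounded, eventually positive or eventually negative, and such that $t^{-\alpha}F(t)\to C_F$ as $t\to\infty$ for some constant $C_F\neq0$ and $F(t)-C_F\,t^\alpha$ is eventually monotone. *)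

theory Defs
  imports "HOL-Analysis.Analysis"
begin

text \<open>
  Functions on \<open>[0,\<infinity>)\<close> or \<open>(0,\<infinity>)\<close> are total functions on the reals of which only the values
  on that domain are used.  Measurable means Lebesgue measurable.
\<close>

definition eventually_signed :: "(real \<Rightarrow> real) \<Rightarrow> bool" where
  "eventually_signed F \<longleftrightarrow>
     (\<forall>\<^sub>F t in at_top. F t > 0) \<or> (\<forall>\<^sub>F t in at_top. F t < 0)"

definition eventually_monotone :: "(real \<Rightarrow> real) \<Rightarrow> bool" where
  "eventually_monotone F \<longleftrightarrow> (\<exists>T. mono_on {T..} F \<or> antimono_on {T..} F)"

definition locally_bounded_on :: "real set \<Rightarrow> (real \<Rightarrow> real) \<Rightarrow> bool" where
  "locally_bounded_on S F \<longleftrightarrow> (\<forall>K. compact K \<and> K \<subseteq> S \<longrightarrow> bounded (F ` K))"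

text \<open>
  Measurability is asked on \<open>(0,\<infinity>)\<close>; for a function on \<open>[0,\<infinity>)\<close> this is the same as
  measurability on its whole domain.
\<close>

definition RV_inf :: "real \<Rightarrow> (real \<Rightarrow> real) set" where
  "RV_inf \<alpha> = {F. F \<in> borel_measurable (lebesgue_on {0<..}) \<and> eventually_signed F \<and>
     (\<forall>x>0. ((\<lambda>t. F (t * x) / F t) \<longlongrightarrow> x powr \<alpha>) at_top)}"

text \<open>The integral is oriented: for \<open>x < 1\<close> it is minus the integral over \<open>(x,1)\<close>.\<close>

definition RV2_inf :: "real \<Rightarrow> real \<Rightarrow> (real \<Rightarrow> real) \<Rightarrow> (real \<Rightarrow> real) set" where
  "RV2_inf \<alpha> \<rho> A = {F. F \<in> RV_inf \<alpha> \<and> eventually_signed A \<and>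
     (\<forall>x>0. ((\<lambda>t. (F (t * x) / F t - x powr \<alpha>) / A t)
        \<longlongrightarrow> x powr \<alpha> * (LBINT u=1..x. u powr (\<rho> - 1))) at_top)}"

definition RV_inf_null :: "real \<Rightarrow> (real \<Rightarrow> real) set" where
  "RV_inf_null \<rho> = {A. A \<in> RV_inf \<rho> \<and> (A \<longlongrightarrow> 0) at_top}"

definition LS_transform :: "(real \<Rightarrow> real) \<Rightarrow> real \<Rightarrow> real" where
  "LS_transform F l = (LINT t:{0..}|lebesgue. l * exp (- (l * t)) * F t)"

definition M_inf_minus :: "real \<Rightarrow> (real \<Rightarrow> real) set" where
  "M_inf_minus \<alpha> = {F. locally_bounded_on {0..} F \<and> eventually_signed F \<and>
     (\<exists>C. C \<noteq> 0 \<and> ((\<lambda>t. t powr (- \<alpha>) * F t) \<longlongrightarrow> C) at_top \<and>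
          eventually_monotone (\<lambda>t. F t - C * t powr \<alpha>))}"

end

theory Submission
  imports Defs
begin

text \<open>
  For \<open>\<rho> < 0\<close> and \<open>A\<close> regularly varying with index \<open>\<rho>\<close> and limit zero, second-order regular
  variation of \<open>F\<close> amounts to a two-term expansion
  \<open>F(t) = C t\<^sup>\<alpha> + (C / \<rho>) t\<^sup>\<alpha> A(t) (1 + o(1))\<close> with \<open>C \<noteq> 0\<close>: summing the increments of
  \<open>t\<^sup>-\<^sup>\<alpha> F(t) (1 - A(t) / \<rho>)\<close> over \<open>t, 2t, 4t, \<dots>\<close> produces the constant and the remainder at once.
  The transform maps \<open>t\<^sup>\<alpha>\<close> to a multiple of itself, so only the remainder
  \<open>F(t) - C t\<^sup>\<alpha>\<close>, of index \<open>\<alpha> + \<rho> > -1\<close>, has to be transferred.  One direction is the Abelian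
  theorem (dominated convergence with Potter bounds); the other is Karamata's Tauberian theorem,
  where the eventual monotonicity of the remainder serves as the Tauberian condition.
\<close>

section \<open>Second-order regular variation as an asymptotic expansion\<close>

text \<open>The Gamma quotient appears because the two terms are multiplied by different constants:
  the power term by \<open>Gamma (\<alpha> + 1)\<close>, a remainder of index \<alpha> + \<rho> by
  \<open>Gamma (\<alpha> + \<rho> + 1)\<close>. Measured against the new leading constant, A is
  rescaled by their ratio. Three obstacles shape the argument. Regular variation is given only
  pointwise and for measurable functions, so every bound uniform in the scaling factor has to be
  extracted from convergence in measure. The remainder may change sign although F is positive, while
  Karamata's approximation needs a nonnegative function; monotonicity fixes the sign of the tail,
  and the head is negligible because \<alpha> + \<rho> > -1 makes \<open>l * \<bar>B l\<bar>\<close>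
  unbounded for B of that index. Finally, the constant in the expansion of the transform is a priori
  unrelated to the constant around which monotonicity is assumed; the first-order Abelian theorem
  identifies the two.\<close>

lemma filterlim_at_top_mult_const:
  fixes c :: real
  assumes "c > 0"
  shows "filterlim (\<lambda>t. t * c) at_top at_top"
  using filterlim_tendsto_pos_mult_at_top[OF tendsto_const[of c] assms filterlim_ident]
  by (simp add: mult.commute)

lemma le_mult_one_le:
  fixes t :: real
  assumes "T \<le> t" "0 < t" "1 \<le> c"
  shows "T \<le> t * c"
  using mult_left_mono[OF assms(3), of t] assms by linarith

text \<open>With \<open>f t = t powr (-\<alpha>) * F t\<close> and \<open>a = f * A\<close>, the
  increment of f from t to 2t is asymptotic to (2^\<rho> - 1) / \<rho> times \<open>a t\<close>, and
  the increment of a to (2^\<rho> - 1) times \<open>a t\<close>. Hence the increment of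
  \<open>h = f - a / \<rho>\<close> is o(\<open>a t\<close>). Since \<rho> < 0, a decays
  geometrically along doublings, so the whole tail of increments is still
  o(\<open>a t\<close>).\<close>

lemma second_order_expansion:
  fixes F A :: "real \<Rightarrow> real"
  assumes F0: "\<forall>\<^sub>F t in at_top. F t \<noteq> 0" and A0: "\<forall>\<^sub>F t in at_top. A t \<noteq> 0"
    and A_lim: "(A \<longlongrightarrow> 0) at_top"
    and A_RV: "\<And>x. x > 0 \<Longrightarrow> ((\<lambda>t. A (t * x) / A t) \<longlongrightarrow> x powr \<rho>) at_top"
    and \<rho>: "\<rho> < 0"
    and F_RV2: "\<And>x. x > 0 \<Longrightarrow> ((\<lambda>t. (F (t * x) / F t - x powr \<alpha>) / A t)
           \<longlongrightarrow> x powr \<alpha> * ((x powr \<rho> - 1) / \<rho>)) at_top"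
  obtains C where "C \<noteq> 0" "((\<lambda>t. (t powr (-\<alpha>) * F t - C) / A t) \<longlongrightarrow> C / \<rho>) at_top"
proof -
  define f where "f t = t powr (-\<alpha>) * F t" for t
  define a where "a t = f t * A t" for t
  define h where "h t = f t - a t / \<rho>" for t
  have f0: "\<forall>\<^sub>F t in at_top. f t \<noteq> 0"
    using F0 eventually_gt_at_top[of 0] by eventually_elim (auto simp: f_def)
  have a0: "\<forall>\<^sub>F t in at_top. a t \<noteq> 0"
    using f0 A0 by eventually_elim (auto simp: a_def)
  have lim_f: "((\<lambda>t. (f (t * x) - f t) / a t) \<longlongrightarrow> (x powr \<rho> - 1) / \<rho>) at_top"
    if x: "x > 0" for x
  proof -
    have "((\<lambda>t. x powr (-\<alpha>) * ((F (t * x) / F t - x powr \<alpha>) / A t))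
           \<longlongrightarrow> x powr (-\<alpha>) * (x powr \<alpha> * ((x powr \<rho> - 1) / \<rho>))) at_top"
      by (intro tendsto_mult tendsto_const F_RV2 x)
    also have "x powr (-\<alpha>) * (x powr \<alpha> * ((x powr \<rho> - 1) / \<rho>)) = (x powr \<rho> - 1) / \<rho>"
      using x by (simp add: powr_minus)
    finally have "((\<lambda>t. x powr (-\<alpha>) * ((F (t * x) / F t - x powr \<alpha>) / A t))
           \<longlongrightarrow> (x powr \<rho> - 1) / \<rho>) at_top" .
    moreover have "\<forall>\<^sub>F t in at_top. x powr (-\<alpha>) * ((F (t * x) / F t - x powr \<alpha>) / A t)
        = (f (t * x) - f t) / a t"
      using F0 A0 eventually_gt_at_top[of 0]
    proof eventually_elim
      case (elim t)
      then show ?case using x unfolding f_def a_def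
        by (simp add: powr_minus powr_mult field_simps)
    qed
    ultimately show ?thesis by (auto simp: tendsto_cong)
  qed
  have lim_a: "((\<lambda>t. a (t * x) / a t) \<longlongrightarrow> x powr \<rho>) at_top" if x: "x > 0" for x
  proof -
    have "((\<lambda>t. (1 + A t * ((f (t * x) - f t) / a t)) * (A (t * x) / A t))
        \<longlongrightarrow> (1 + 0 * ((x powr \<rho> - 1) / \<rho>)) * x powr \<rho>) at_top"
      by (intro tendsto_intros A_lim lim_f A_RV x)
    moreover have "\<forall>\<^sub>F t in at_top. (1 + A t * ((f (t * x) - f t) / a t)) * (A (t * x) / A t)
        = a (t * x) / a t"
      using f0 A0 by eventually_elim (simp add: a_def field_simps)
    ultimately show ?thesis by (auto simp: tendsto_cong)
  qed
  \<comment> \<open>The midpoint between the limit 2^\<rho> of \<open>a (t * 2) / a t\<close> and 1: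
    far enough above the limit to hold eventually, and still a ratio of a convergent geometric
    series.\<close>
  define q where "q = (1 + 2 powr \<rho>) / 2"
  have "(2::real) powr \<rho> < 2 powr 0" using \<rho> by (intro powr_less_mono) auto
  then have q: "2 powr \<rho> < q" "q < 1" "q > 0" using powr_gt_zero[of 2 \<rho>] 
    by (auto simp: q_def simp del: powr_gt_zero)
  have ev_a: "\<forall>\<^sub>F t in at_top. \<bar>a (t * 2)\<bar> \<le> q * \<bar>a t\<bar>"
  proof -
    have "((\<lambda>t. \<bar>a (t * 2) / a t\<bar>) \<longlongrightarrow> \<bar>2 powr \<rho>\<bar>) at_top"
      by (intro tendsto_rabs lim_a) simp
    then have "\<forall>\<^sub>F t in at_top. \<bar>a (t * 2) / a t\<bar> < q"
      using q(1) by (intro order_tendstoD(2)) auto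
    then show ?thesis using a0 by eventually_elim (simp add: abs_divide field_simps)
  qed
  have lim_h: "((\<lambda>t. (h (t * 2) - h t) / a t) \<longlongrightarrow> 0) at_top"
  proof -
    have "((\<lambda>t. (f (t * 2) - f t) / a t - (a (t * 2) / a t - 1) / \<rho>)
        \<longlongrightarrow> (2 powr \<rho> - 1) / \<rho> - (2 powr \<rho> - 1) / \<rho>) at_top"
      using \<rho> by (intro tendsto_intros lim_f lim_a) auto
    moreover have "\<forall>\<^sub>F t in at_top. (f (t * 2) - f t) / a t - (a (t * 2) / a t - 1) / \<rho>
        = (h (t * 2) - h t) / a t"
      using a0 by eventually_elim (use \<rho> in \<open>simp add: h_def field_simps\<close>)
    ultimately show ?thesis by (auto simp: tendsto_cong)
  qed
  \<comment> \<open>At this stage the limit c may depend on the starting point t. The error bound is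
    linear in \<epsilon>, which later turns it into o(\<open>a t\<close>).\<close>
  have key: "\<exists>T>0. \<forall>t\<ge>T. \<exists>c. (\<lambda>n. f (t * 2 ^ n)) \<longlonglongrightarrow> c \<and> (\<lambda>n. a (t * 2 ^ n)) \<longlonglongrightarrow> 0 \<and>
       \<bar>c - h t\<bar> \<le> \<epsilon> * \<bar>a t\<bar> / (1 - q)" if \<epsilon>: "\<epsilon> > 0" for \<epsilon>
  proof -
    have "\<forall>\<^sub>F t in at_top. \<bar>(h (t * 2) - h t) / a t\<bar> < \<epsilon>"
      using lim_h \<epsilon> by (auto simp: tendsto_iff dist_real_def)
    then have ev_h: "\<forall>\<^sub>F t in at_top. \<bar>h (t * 2) - h t\<bar> \<le> \<epsilon> * \<bar>a t\<bar>"
      using a0 by eventually_elim (simp add: abs_divide field_simps)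
    from eventually_conj[OF ev_a ev_h] eventually_gt_at_top[of 0]
    have "\<forall>\<^sub>F t in at_top. t > 0 \<and> \<bar>a (t * 2)\<bar> \<le> q * \<bar>a t\<bar> \<and> \<bar>h (t * 2) - h t\<bar> \<le> \<epsilon> * \<bar>a t\<bar>"
      by eventually_elim auto
    then obtain T where T: "\<And>t. t \<ge> T \<Longrightarrow> t > 0" "\<And>t. t \<ge> T \<Longrightarrow> \<bar>a (t * 2)\<bar> \<le> q * \<bar>a t\<bar>"
        "\<And>t. t \<ge> T \<Longrightarrow> \<bar>h (t * 2) - h t\<bar> \<le> \<epsilon> * \<bar>a t\<bar>"
      unfolding eventually_at_top_linorder by blast
    have "\<exists>c. (\<lambda>n. f (t * 2 ^ n)) \<longlonglongrightarrow> c \<and> (\<lambda>n. a (t * 2 ^ n)) \<longlonglongrightarrow> 0 \<and>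
       \<bar>c - h t\<bar> \<le> \<epsilon> * \<bar>a t\<bar> / (1 - q)" if t: "t \<ge> T" for t
    proof -
      have tn: "t * 2 ^ n \<ge> T" for n :: nat
        by (intro le_mult_one_le t T(1)[OF t]) simp
      have an: "\<bar>a (t * 2 ^ n)\<bar> \<le> q ^ n * \<bar>a t\<bar>" for n
      proof (induction n)
        case (Suc n)
        have "\<bar>a (t * 2 ^ Suc n)\<bar> \<le> q * \<bar>a (t * 2 ^ n)\<bar>"
          using T(2)[OF tn[of n]] by (simp add: mult_ac)
        also have "\<dots> \<le> q * (q ^ n * \<bar>a t\<bar>)" using Suc q by (intro mult_left_mono) auto
        finally show ?case by simp
      qed simp
      have qn: "(\<lambda>n. q ^ n * \<bar>a t\<bar>) \<longlonglongrightarrow> 0"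
        using q by (intro tendsto_mult_left_zero LIMSEQ_realpow_zero) auto
      have a_lim: "(\<lambda>n. a (t * 2 ^ n)) \<longlonglongrightarrow> 0"
        by (rule tendsto_rabs_zero_cancel, rule tendsto_sandwich[OF _ _ tendsto_const qn])
           (use an in auto)
      define d where "d n = h (t * 2 ^ Suc n) - h (t * 2 ^ n)" for n
      have dn: "norm (d n) \<le> \<epsilon> * \<bar>a t\<bar> * q ^ n" for n
      proof -
        have "norm (d n) \<le> \<epsilon> * \<bar>a (t * 2 ^ n)\<bar>"
          using T(3)[OF tn[of n]] by (simp add: mult_ac d_def)
        also have "\<dots> \<le> \<epsilon> * (q ^ n * \<bar>a t\<bar>)" using an \<epsilon> by (intro mult_left_mono) auto
        finally show ?thesis by (simp add: mult_ac)
      qed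
      have geo: "(\<lambda>n. \<epsilon> * \<bar>a t\<bar> * q ^ n) sums (\<epsilon> * \<bar>a t\<bar> * (1 / (1 - q)))"
        using q by (intro sums_mult geometric_sums) auto
      have "summable (\<lambda>n. norm (d n))"
        by (rule summable_comparison_test'[OF sums_summable[OF geo], of 0]) (use dn in auto)
      note sd = this summable_norm_cancel[OF this]
      have "norm (suminf d) \<le> (\<Sum>n. norm (d n))" by (rule summable_norm[OF sd(1)])
      also have "\<dots> \<le> (\<Sum>n. \<epsilon> * \<bar>a t\<bar> * q ^ n)"
        by (rule suminf_le[OF dn sd(1) sums_summable[OF geo]])
      also have "\<dots> = \<epsilon> * \<bar>a t\<bar> / (1 - q)" using sums_unique[OF geo] by simp
      finally have sb: "\<bar>suminf d\<bar> \<le> \<epsilon> * \<bar>a t\<bar> / (1 - q)" by simp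
      have "(\<lambda>n. \<Sum>k<n. d k) \<longlonglongrightarrow> suminf d" by (rule summable_LIMSEQ[OF sd(2)])
      moreover have "(\<Sum>k<n. d k) = h (t * 2 ^ n) - h t" for n
        unfolding d_def using sum_lessThan_telescope[of "\<lambda>n. h (t * 2 ^ n)" n] by simp
      ultimately have "(\<lambda>n. (h (t * 2 ^ n) - h t) + h t + a (t * 2 ^ n) / \<rho>) \<longlonglongrightarrow> suminf d + h t + 0 / \<rho>"
        using \<rho> by (intro tendsto_intros a_lim) auto
      then have "(\<lambda>n. f (t * 2 ^ n)) \<longlonglongrightarrow> suminf d + h t" by (simp add: h_def)
      with a_lim sb show ?thesis by (intro exI[of _ "suminf d + h t"]) auto
    qed
    moreover have "max T 1 > 0" by simp
    ultimately show ?thesis by (intro exI[of _ "max T 1"]) auto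
  qed
  obtain T0 where T0: "T0 > 0" "\<And>t. t \<ge> T0 \<Longrightarrow>
      \<exists>c. (\<lambda>n. f (t * 2 ^ n)) \<longlonglongrightarrow> c \<and> (\<lambda>n. a (t * 2 ^ n)) \<longlonglongrightarrow> 0"
    using key[of 1] by fastforce
  obtain C where C: "(\<lambda>n. f (T0 * 2 ^ n)) \<longlonglongrightarrow> C" and aT: "(\<lambda>n. a (T0 * 2 ^ n)) \<longlonglongrightarrow> 0"
    using T0(2)[of T0] by auto
  have seq: "filterlim (\<lambda>n. T0 * 2 ^ n) at_top sequentially"
  proof (rule filterlim_tendsto_pos_mult_at_top[OF tendsto_const T0(1)])
    show "filterlim (\<lambda>n. 2 ^ n :: real) at_top sequentially"
      by (rule filterlim_at_infinity_imp_filterlim_at_top[OF filterlim_realpow_sequentially_gt1]) auto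
  qed
  \<comment> \<open>Two dyadic orbits differ by a fixed factor x. The difference of f along them is
    O of \<open>a (T0 * 2 ^ n)\<close>, which tends to 0, so all orbits share one limit.\<close>
  have same: "(\<lambda>n. f (t * 2 ^ n)) \<longlonglongrightarrow> C" if t: "t \<ge> T0" for t
  proof -
    define x where "x = t / T0"
    have x: "x > 0" "t = T0 * x" using t T0(1) by (auto simp: x_def)
    have "(\<lambda>n. (f (T0 * 2 ^ n * x) - f (T0 * 2 ^ n)) / a (T0 * 2 ^ n) * a (T0 * 2 ^ n) + f (T0 * 2 ^ n))
        \<longlonglongrightarrow> (x powr \<rho> - 1) / \<rho> * 0 + C"
      by (intro tendsto_add tendsto_mult C aT filterlim_compose[OF lim_f[OF x(1)] seq])
    moreover have "\<forall>\<^sub>F n in sequentially.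
        (f (T0 * 2 ^ n * x) - f (T0 * 2 ^ n)) / a (T0 * 2 ^ n) * a (T0 * 2 ^ n) + f (T0 * 2 ^ n) = f (t * 2 ^ n)"
      using filterlim_iff[THEN iffD1, OF seq, rule_format, OF a0]
      by eventually_elim (simp add: x(2) mult_ac)
    ultimately show ?thesis by (auto simp: tendsto_cong)
  qed
  have lim_C: "((\<lambda>t. (C - h t) / a t) \<longlongrightarrow> 0) at_top"
  proof (rule tendstoI)
    fix e :: real assume e: "e > 0"
    \<comment> \<open>Makes \<open>\<epsilon> / (1 - q)\<close> equal to \<open>e / 2\<close>,
      leaving room for the strict inequality.\<close>
    define \<epsilon> where "\<epsilon> = e * (1 - q) / 2"
    have \<epsilon>: "\<epsilon> > 0" using e q by (simp add: \<epsilon>_def)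
    obtain T where T: "\<And>t. t \<ge> T \<Longrightarrow> \<exists>c. (\<lambda>n. f (t * 2 ^ n)) \<longlonglongrightarrow> c \<and>
       \<bar>c - h t\<bar> \<le> \<epsilon> * \<bar>a t\<bar> / (1 - q)" using key[OF \<epsilon>] by blast
    show "\<forall>\<^sub>F t in at_top. dist ((C - h t) / a t) 0 < e"
      using eventually_ge_at_top[of T] eventually_ge_at_top[of T0] a0
    proof eventually_elim
      case (elim t)
      obtain c where c: "(\<lambda>n. f (t * 2 ^ n)) \<longlonglongrightarrow> c" "\<bar>c - h t\<bar> \<le> \<epsilon> * \<bar>a t\<bar> / (1 - q)"
        using T elim by blast
      have "c = C" using LIMSEQ_unique[OF c(1) same] elim by auto
      moreover have "\<epsilon> * \<bar>a t\<bar> / (1 - q) = e / 2 * \<bar>a t\<bar>"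
        using q by (simp add: \<epsilon>_def divide_simps)
      ultimately have "\<bar>C - h t\<bar> \<le> e / 2 * \<bar>a t\<bar>" using c(2) by metis
      then have "\<bar>(C - h t) / a t\<bar> \<le> e / 2" using elim by (simp add: abs_divide field_simps)
      then show ?case using e unfolding dist_real_def by linarith
    qed
  qed
  have lim_fa: "((\<lambda>t. (f t - C) / a t) \<longlongrightarrow> 1 / \<rho>) at_top"
  proof -
    have "((\<lambda>t. 1 / \<rho> - (C - h t) / a t) \<longlongrightarrow> 1 / \<rho> - 0) at_top"
      by (intro tendsto_intros lim_C)
    moreover have "\<forall>\<^sub>F t in at_top. 1 / \<rho> - (C - h t) / a t = (f t - C) / a t"
      using a0 by eventually_elim (use \<rho> in \<open>simp add: h_def field_simps\<close>)
    ultimately show ?thesis by (auto simp: tendsto_cong)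
  qed
  \<comment> \<open>The quotient is taken as \<open>C / f\<close> rather than \<open>f / C\<close>
    because C might still be 0; the limit 1 is exactly what excludes this.\<close>
  have lim_Cf: "((\<lambda>t. C / f t) \<longlongrightarrow> 1) at_top"
  proof -
    have "((\<lambda>t. 1 - (f t - C) / a t * A t) \<longlongrightarrow> 1 - 1 / \<rho> * 0) at_top"
      by (intro tendsto_intros lim_fa A_lim)
    moreover have "\<forall>\<^sub>F t in at_top. 1 - (f t - C) / a t * A t = C / f t"
      using f0 A0 by eventually_elim (simp add: a_def field_simps)
    ultimately show ?thesis by (auto simp: tendsto_cong)
  qed
  have C0: "C \<noteq> 0"
  proof
    assume "C = 0"
    with lim_Cf have "((\<lambda>t::real. 0::real) \<longlongrightarrow> 1) at_top" by simp
    then show False using tendsto_unique[OF _ tendsto_const] trivial_limit_at_top_linorder by fastforce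
  qed
  have "((\<lambda>t. C / (C / f t) * ((f t - C) / a t)) \<longlongrightarrow> C / 1 * (1 / \<rho>)) at_top"
    by (intro tendsto_intros lim_Cf lim_fa) auto
  moreover have "\<forall>\<^sub>F t in at_top. C / (C / f t) * ((f t - C) / a t) = (f t - C) / A t"
    using f0 A0 by eventually_elim (use C0 in \<open>simp add: a_def field_simps\<close>)
  ultimately have "((\<lambda>t. (f t - C) / A t) \<longlongrightarrow> C / \<rho>) at_top" by (auto simp: tendsto_cong)
  with C0 show ?thesis using that by (simp add: f_def)
qed

text \<open>The increment of f is the difference of its deviations from C at t * x and at t, and
  \<open>A (t * x) / A t\<close> compares the two on the scale \<open>A t\<close>. The first
  conclusion is also what pins down C when a second expansion has to be matched with it.\<close>

lemma second_order_of_expansion: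
  fixes F A :: "real \<Rightarrow> real"
  assumes C: "C \<noteq> 0" and F: "((\<lambda>t. (t powr (-\<alpha>) * F t - C) / A t) \<longlongrightarrow> C / \<rho>) at_top"
    and A0: "\<forall>\<^sub>F t in at_top. A t \<noteq> 0" and A_lim: "(A \<longlongrightarrow> 0) at_top"
    and A_RV: "\<And>x. x > 0 \<Longrightarrow> ((\<lambda>t. A (t * x) / A t) \<longlongrightarrow> x powr \<rho>) at_top"
    and \<rho>: "\<rho> < 0"
  shows "((\<lambda>t. t powr (-\<alpha>) * F t) \<longlongrightarrow> C) at_top"
    and "x > 0 \<Longrightarrow> ((\<lambda>t. F (t * x) / F t) \<longlongrightarrow> x powr \<alpha>) at_top"
    and "x > 0 \<Longrightarrow> ((\<lambda>t. (F (t * x) / F t - x powr \<alpha>) / A t)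
           \<longlongrightarrow> x powr \<alpha> * ((x powr \<rho> - 1) / \<rho>)) at_top"
proof -
  define f where "f t = t powr (-\<alpha>) * F t" for t
  have F': "((\<lambda>t. (f t - C) / A t) \<longlongrightarrow> C / \<rho>) at_top" using F by (simp add: f_def)
  have lim_f: "(f \<longlongrightarrow> C) at_top"
  proof -
    have "((\<lambda>t. (f t - C) / A t * A t + C) \<longlongrightarrow> C / \<rho> * 0 + C) at_top"
      by (intro tendsto_intros F' A_lim)
    moreover have "\<forall>\<^sub>F t in at_top. (f t - C) / A t * A t + C = f t"
      using A0 by eventually_elim simp
    ultimately show ?thesis by (auto simp: tendsto_cong)
  qed
  then show "((\<lambda>t. t powr (-\<alpha>) * F t) \<longlongrightarrow> C) at_top" by (simp add: f_def[abs_def])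
  have f0: "\<forall>\<^sub>F t in at_top. f t \<noteq> 0" using tendsto_imp_eventually_ne[OF lim_f C] .
  assume x: "x > 0"
  note fx = filterlim_at_top_mult_const[OF x]
  have "((\<lambda>t. x powr \<alpha> * (f (t * x) / f t)) \<longlongrightarrow> x powr \<alpha> * (C / C)) at_top"
    using C by (intro tendsto_intros lim_f filterlim_compose[OF lim_f fx])
  moreover have "\<forall>\<^sub>F t in at_top. x powr \<alpha> * (f (t * x) / f t) = F (t * x) / F t"
    using eventually_gt_at_top[of 0]
    by eventually_elim (use x in \<open>simp add: f_def powr_mult powr_minus field_simps\<close>)
  ultimately show "((\<lambda>t. F (t * x) / F t) \<longlongrightarrow> x powr \<alpha>) at_top" using C by (auto simp: tendsto_cong)
  have "((\<lambda>t. x powr \<alpha> * (((f (t * x) - C) / A (t * x) * (A (t * x) / A t) - (f t - C) / A t) / f t))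
      \<longlongrightarrow> x powr \<alpha> * ((C / \<rho> * x powr \<rho> - C / \<rho>) / C)) at_top"
    using C by (intro tendsto_intros lim_f F' A_RV[OF x] filterlim_compose[OF F' fx])
  moreover have "x powr \<alpha> * ((C / \<rho> * x powr \<rho> - C / \<rho>) / C) = x powr \<alpha> * ((x powr \<rho> - 1) / \<rho>)"
    using C \<rho> by (simp add: field_simps)
  moreover have "\<forall>\<^sub>F t in at_top. x powr \<alpha> * (((f (t * x) - C) / A (t * x) * (A (t * x) / A t) - (f t - C) / A t) / f t)
      = (F (t * x) / F t - x powr \<alpha>) / A t"
    using eventually_gt_at_top[of 0] f0 A0 fx[unfolded filterlim_iff, rule_format, OF A0]
  proof eventually_elim
    case (elim t)
    have "x powr \<alpha> * f (t * x) / f t = F (t * x) / F t"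
      using elim x by (simp add: f_def powr_mult powr_minus field_simps)
    moreover have "((f (t * x) - C) / A (t * x) * (A (t * x) / A t) - (f t - C) / A t) / f t = (f (t * x) / f t - 1) / A t"
      using elim by (simp add: field_simps)
    ultimately show ?case by (simp add: algebra_simps)
  qed
  ultimately show "((\<lambda>t. (F (t * x) / F t - x powr \<alpha>) / A t)
           \<longlongrightarrow> x powr \<alpha> * ((x powr \<rho> - 1) / \<rho>)) at_top" by (auto simp: tendsto_cong)
qed

text \<open>The antiderivative covers both orientations, hence the \<open>min\<close> and
  \<open>max\<close> in the proof. In this closed form the limit function of \<open>RV2_inf\<close>
  meets the expansion lemmas.\<close>

lemma LBINT_powr_from_1:
  assumes "x > 0" "\<rho> \<noteq> 0"
  shows "(LBINT u=1..x. u powr (\<rho> - 1)) = (x powr \<rho> - 1) / \<rho>"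
proof -
  have "(LBINT u=ereal 1..ereal x. u powr (\<rho> - 1)) = x powr \<rho> / \<rho> - 1 powr \<rho> / \<rho>"
  proof (rule interval_integral_FTC_finite)
    show "continuous_on {min 1 x..max 1 x} (\<lambda>u. u powr (\<rho> - 1))"
      using assms by (intro continuous_intros) auto
    show "((\<lambda>u. u powr \<rho> / \<rho>) has_vector_derivative u powr (\<rho> - 1)) (at u within {min 1 x..max 1 x})"
      if "min 1 x \<le> u" "u \<le> max 1 x" for u
      using that assms unfolding has_real_derivative_iff_has_vector_derivative[symmetric]
      by (auto intro!: derivative_eq_intros)
  qed
  then show ?thesis by (simp add: one_ereal_def diff_divide_distrib)
qed

section \<open>Potter bounds\<close>

lemma RV_infD:
  assumes "B \<in> RV_inf \<beta>"
  shows "\<And>x. x > 0 \<Longrightarrow> ((\<lambda>t. B (t * x) / B t) \<longlongrightarrow> x powr \<beta>) at_top"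
    and "\<forall>\<^sub>F t in at_top. B t \<noteq> 0"
    and "B \<in> borel_measurable (lebesgue_on {0<..})"
  using assms by (auto simp: RV_inf_def eventually_signed_def elim: eventually_mono)

text \<open>Dilations preserve Lebesgue measurability because they respect null sets; composition
  with an arbitrary continuous map would not. The indicator extends the function by zero to the
  whole line.\<close>

lemma borel_measurable_lebesgue_scale:
  fixes B :: "real \<Rightarrow> real"
  assumes B: "B \<in> borel_measurable (lebesgue_on {0<..})" and t: "t > 0"
  shows "(\<lambda>x. indicator {0<..} x * B (t * x)) \<in> borel_measurable lebesgue"
proof -
  have "(\<lambda>x. indicator {0<..} x *\<^sub>R B x) \<in> borel_measurable lebesgue"
    using B by (subst (asm) borel_measurable_restrict_space_iff) auto
  then have "(\<lambda>x. indicator {0<..} (t * x) *\<^sub>R B (t * x)) \<in> borel_measurable lebesgue"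
    using measurable_compose[OF lebesgue_measurable_scaling[of t], of "\<lambda>x. indicator {0<..} x *\<^sub>R B x" borel]
    by (simp only: real_scaleR_def)
  moreover have "indicator {0<..} (t * x) = (indicator {0<..} x :: real)" for x
    using t by (simp add: indicator_def zero_less_mult_iff)
  ultimately show ?thesis by simp
qed

text \<open>Convergence in measure of the quotients on a bounded set replaces the uniform convergence
  theorem: two good factors \<open>y\<close> and \<open>y / x\<close> control the quotient at \<open>x\<close>.\<close>

lemma RV_inf_locally_bounded_quotient:
  assumes B: "B \<in> RV_inf \<beta>"
  obtains T L where "T > 0" "L > 1"
    "\<And>t x. t \<ge> T \<Longrightarrow> 1 \<le> x \<Longrightarrow> x \<le> 2 \<Longrightarrow> 1 / L < B (t * x) / B t \<and> B (t * x) / B t < L"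
proof -
  note BD = RV_infD[OF B]
  \<comment> \<open>Chosen so that the open interval from 1 / L to L contains every limit
    \<open>x powr \<beta>\<close> with x in [1,4]. The range up to 4 is needed because y will lie in
    [2,4] and y / x in [1,4].\<close>
  define L :: real where "L = 4 powr \<bar>\<beta>\<bar> + 1"
  have L: "L > 1" by (simp add: L_def)
  have xL: "1 / L < x powr \<beta> \<and> x powr \<beta> < L" if "1 \<le> x" "x \<le> 4" for x
  proof -
    have "x powr \<bar>\<beta>\<bar> \<le> 4 powr \<bar>\<beta>\<bar>" using that by (intro powr_mono2) auto
    then have 1: "x powr \<bar>\<beta>\<bar> < L" by (simp add: L_def)
    moreover have "x powr \<beta> \<le> x powr \<bar>\<beta>\<bar>" using that by (intro powr_mono) auto
    moreover have "x powr (-\<bar>\<beta>\<bar>) \<le> x powr \<beta>" using that by (intro powr_mono) auto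
    moreover have "1 / L < x powr (-\<bar>\<beta>\<bar>)"
      using 1 that L by (simp add: powr_minus field_simps)
    ultimately show ?thesis by auto
  qed
  define good where "good t x \<longleftrightarrow> 1 / L < B (t * x) / B t \<and> B (t * x) / B t < L" for t x
  define bad where "bad t = {x \<in> {1..4}. \<not> good t x}" for t
  have bad_meas: "bad t \<in> sets lebesgue" if t: "t > 0" for t
  proof -
    note [measurable] = borel_measurable_lebesgue_scale[OF BD(3) t]
    define g where "g = (\<lambda>x. indicator {0<..} x * B (t * x))"
    have g: "(\<lambda>x. g x / B t) \<in> borel_measurable lebesgue"
      unfolding g_def by measurable
    have "(\<lambda>x. g x / B t) -` {1/L<..<L} \<inter> space lebesgue \<in> sets lebesgue"
      by (rule measurable_sets[OF g]) auto
    then have "{1..4} - ((\<lambda>x. g x / B t) -` {1/L<..<L} \<inter> space lebesgue) \<in> sets lebesgue" by auto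
    also have "{1..4} - ((\<lambda>x. g x / B t) -` {1/L<..<L} \<inter> space lebesgue) = bad t"
      by (auto simp: bad_def good_def g_def)
    finally show ?thesis .
  qed
  \<comment> \<open>The dominated convergence rule wants measurability for every t, but
    \<open>bad t\<close> is known to be measurable only for t > 0.\<close>
  define s where "s t = (if t > 0 then indicator (bad t) else (\<lambda>_. 0 :: real))" for t :: real
  have "((\<lambda>t. integral\<^sup>L lebesgue (s t)) \<longlongrightarrow> integral\<^sup>L lebesgue (\<lambda>_::real. 0::real)) at_top"
  proof (rule integral_dominated_convergence_at_top)
    show "integrable lebesgue (indicator {1..4::real} :: real \<Rightarrow> real)"
      by (rule integrable_real_indicator) auto
    show "s t \<in> borel_measurable lebesgue" for t using bad_meas[of t] by (auto simp: s_def)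
    show "\<forall>\<^sub>F t in at_top. AE x in lebesgue. norm (s t x) \<le> indicator {1..4} x"
      by (intro always_eventually allI AE_I2) (auto simp: s_def bad_def indicator_def)
    have "((\<lambda>t. s t x) \<longlongrightarrow> 0) at_top" for x
    proof (cases "1 \<le> x \<and> x \<le> 4")
      case True
      then have "\<forall>\<^sub>F t in at_top. good t x"
        unfolding good_def using xL[of x] BD(1)[of x]
        by (intro eventually_conj order_tendstoD[of "\<lambda>t. B (t * x) / B t" "x powr \<beta>"]) auto
      then have "\<forall>\<^sub>F t in at_top. s t x = 0" by eventually_elim (simp add: s_def bad_def)
      then show ?thesis by (rule tendsto_eventually)
    next
      case False
      then have "s t x = 0" for t by (auto simp: s_def bad_def)
      then show ?thesis by simp
    qed
    then show "AE x in lebesgue. ((\<lambda>t. s t x) \<longlongrightarrow> 0) at_top" by simp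
  qed auto
  then have "((\<lambda>t. integral\<^sup>L lebesgue (s t)) \<longlongrightarrow> 0) at_top" by simp
  \<comment> \<open>With 1/2, the set \<open>bad t\<close> together with the x-fold dilation of
    \<open>bad (t * x)\<close>, x at most 2, has measure below 1/2 + 1 and cannot cover [2,4], of
    measure 2.\<close>
  then have "\<forall>\<^sub>F t in at_top. integral\<^sup>L lebesgue (s t) < 1/2" by (rule order_tendstoD) simp
  from this eventually_gt_at_top[of 0] BD(2)
  have "\<forall>\<^sub>F t in at_top. t > 0 \<and> B t \<noteq> 0 \<and> measure lebesgue (bad t) < 1/2"
    by eventually_elim (simp add: s_def)
  then obtain T where T: "\<And>t. t \<ge> T \<Longrightarrow> t > 0" "\<And>t. t \<ge> T \<Longrightarrow> B t \<noteq> 0"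
     "\<And>t. t \<ge> T \<Longrightarrow> measure lebesgue (bad t) < 1/2"
    unfolding eventually_at_top_linorder by blast
  \<comment> \<open>The square arises from \<open>B (t * x) / B t\<close> being the quotient of
    \<open>B (t * y) / B t\<close> by \<open>B (t * y) / B (t * x)\<close>, each lying between 1 / L
    and L for a suitable y.\<close>
  have "1 / L\<^sup>2 < B (t * x) / B t \<and> B (t * x) / B t < L\<^sup>2" if t: "t \<ge> T" and x: "1 \<le> x" "x \<le> 2" for t x
  proof -
    have tx: "t * x \<ge> T" by (intro le_mult_one_le t T(1)[OF t] x)
    note t0 = T(1)[OF t] T(1)[OF tx]
    have fin: "bad t \<in> lmeasurable" if "t > 0" for t
      by (rule bounded_set_imp_lmeasurable[OF _ bad_meas[OF that]])
         (rule bounded_subset[of "{1..4}"], auto simp: bad_def)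
    have m2: "measure lebesgue ((\<lambda>y. x * y) ` bad (t * x)) = x * measure lebesgue (bad (t * x))"
      using measure_lebesgue_affine[of x 0 "bad (t * x)"] x by simp
    have l2: "(\<lambda>y. x * y) ` bad (t * x) \<in> lmeasurable"
    proof (rule bounded_set_imp_lmeasurable)
      have "(*\<^sub>R) (1 / x) -` bad (t * x) \<inter> space lebesgue \<in> sets lebesgue"
        by (rule measurable_sets[OF lebesgue_measurable_scaling bad_meas[OF t0(2)]])
      also have "(*\<^sub>R) (1 / x) -` bad (t * x) \<inter> space lebesgue = (\<lambda>y. x * y) ` bad (t * x)"
        using x by (force simp: image_iff)
      finally show "(\<lambda>y. x * y) ` bad (t * x) \<in> sets lebesgue" .
      have "bounded ((*\<^sub>R) x ` bad (t * x))"
        by (rule bounded_scaling, rule bounded_subset[of "{1..4}"]) (auto simp: bad_def)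
      then show "bounded ((\<lambda>y. x * y) ` bad (t * x))" by simp
    qed
    have "measure lebesgue (bad t \<union> (\<lambda>y. x * y) ` bad (t * x)) < 3/2"
    proof -
      have "measure lebesgue (bad t \<union> (\<lambda>y. x * y) ` bad (t * x))
         \<le> measure lebesgue (bad t) + x * measure lebesgue (bad (t * x))"
        unfolding m2[symmetric] using fin[OF t0(1)] l2
        by (intro measure_Un_le) (auto simp: fmeasurable_def)
      also have "x * measure lebesgue (bad (t * x)) \<le> 2 * (1/2)"
        using x T(3)[OF tx] by (intro mult_mono) auto
      finally show ?thesis using T(3)[OF t] by simp
    qed
    moreover have "measure lebesgue {2..4::real} = 2" by simp
    ultimately have "\<not> {2..4} \<subseteq> bad t \<union> (\<lambda>y. x * y) ` bad (t * x)"
      using measure_mono_fmeasurable[of "{2..4}" "bad t \<union> (\<lambda>y. x * y) ` bad (t * x)" lebesgue]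
        fin[OF t0(1)] l2 by (auto simp: fmeasurable.Un)
    then obtain y where "y \<in> {2..4}" "y \<notin> bad t \<union> (\<lambda>y. x * y) ` bad (t * x)" by blast
    then have y: "2 \<le> y" "y \<le> 4" "y \<notin> bad t" "y \<notin> (\<lambda>y. x * y) ` bad (t * x)" by simp_all
    have g1: "good t y" using y by (auto simp: bad_def)
    have "y / x \<notin> bad (t * x)" using y(4) x by force
    then have "good (t * x) (y / x)" using y x by (auto simp: bad_def field_simps)
    then have g2: "1 / L < B (t * y) / B (t * x)" "B (t * y) / B (t * x) < L"
      using x by (auto simp: good_def)
    define p r where "p = B (t * y) / B t" and "r = B (t * y) / B (t * x)"
    have pr: "1 / L < p" "p < L" "1 / L < r" "r < L" using g1 g2 by (auto simp: good_def p_def r_def)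
    have pos: "p > 0" "r > 0" using pr L by (meson less_trans zero_less_divide_1_iff zero_less_one)+
    have eq: "B (t * x) / B t = p / r"
      using pos T(2)[OF t] T(2)[OF tx] by (auto simp: p_def r_def field_simps)
    have "p / r < L / (1 / L)" using pr pos L by (intro frac_less) auto
    moreover have "(1 / L) / L < p / r" using pr pos L by (intro frac_less) auto
    ultimately show ?thesis using L by (simp add: eq power2_eq_square)
  qed
  moreover have "T > 0" using T(1) by simp
  moreover have "L\<^sup>2 > 1" using L by (simp add: one_less_power)
  ultimately show ?thesis using that by blast
qed

text \<open>Doubling costs at most a factor 2^(\<beta> + \<epsilon>) and at least 2^(\<beta> -
  \<epsilon>), with no constant accumulating; what is left of s / t after the doublings is a factor
  in [1,2], covered by the local bound. The sum of two powers serves s \<ge> t and s < t at once,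
  which is the shape wanted for an integrable majorant.\<close>

lemma potter_bounds:
  assumes B: "B \<in> RV_inf \<beta>" and e: "\<epsilon> > 0"
  obtains T K where "T > 0" "K > 0"
    "\<And>s t. s \<ge> T \<Longrightarrow> t \<ge> T \<Longrightarrow> 0 < B s / B t \<and>
       B s / B t \<le> K * ((s / t) powr (\<beta> + \<epsilon>) + (s / t) powr (\<beta> - \<epsilon>))"
proof -
  note BD = RV_infD[OF B]
  obtain T0 L where T0: "T0 > 0" and L: "L > 1"
    "\<And>t x. t \<ge> T0 \<Longrightarrow> 1 \<le> x \<Longrightarrow> x \<le> 2 \<Longrightarrow> 1 / L < B (t * x) / B t \<and> B (t * x) / B t < L"
    using RV_inf_locally_bounded_quotient[OF B] by blast
  have "\<forall>\<^sub>F t in at_top. 2 powr (\<beta> - \<epsilon>) < B (t * 2) / B t \<and> B (t * 2) / B t < 2 powr (\<beta> + \<epsilon>)"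
    using e by (intro eventually_conj order_tendstoD[OF BD(1)]) auto
  then obtain T1 where T1: "\<And>t. t \<ge> T1 \<Longrightarrow> 2 powr (\<beta> - \<epsilon>) < B (t * 2) / B t \<and> B (t * 2) / B t < 2 powr (\<beta> + \<epsilon>)"
    unfolding eventually_at_top_linorder by blast
  define T where "T = max T0 T1"
  have T: "T > 0" using T0 by (simp add: T_def)
  have B0: "B t \<noteq> 0" if "t \<ge> T" for t
    using L(2)[of t 1] that L(1) by (auto simp: T_def)
  have dyadic: "2 powr (real n * (\<beta> - \<epsilon>)) \<le> B (t * 2 ^ n) / B t \<and> B (t * 2 ^ n) / B t \<le> 2 powr (real n * (\<beta> + \<epsilon>))"
    if t: "t \<ge> T" for t n
  proof (induction n)
    case 0
    then show ?case using B0[OF t] by simp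
  next
    case (Suc n)
    have tn: "t * 2 ^ n \<ge> T" using t T by (intro le_mult_one_le) auto
    have eq: "B (t * 2 ^ Suc n) / B t = B (t * 2 ^ n) / B t * (B (t * 2 ^ n * 2) / B (t * 2 ^ n))"
      using B0[OF tn] B0[OF t] by (simp add: mult_ac)
    have tn1: "t * 2 ^ n \<ge> T1" using tn by (simp add: T_def)
    have nonneg: "0 \<le> B (t * 2 ^ n) / B t" "0 \<le> B (t * 2 ^ n * 2) / B (t * 2 ^ n)"
      using order_trans[OF powr_ge_zero Suc[THEN conjunct1]]
        order_trans[OF powr_ge_zero less_imp_le[OF T1[OF tn1, THEN conjunct1]]] .
    have "2 powr (real n * (\<beta> - \<epsilon>)) * 2 powr (\<beta> - \<epsilon>) \<le> B (t * 2 ^ Suc n) / B t"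
      unfolding eq using Suc T1[OF tn1] nonneg by (intro mult_mono) auto
    moreover have "B (t * 2 ^ Suc n) / B t \<le> 2 powr (real n * (\<beta> + \<epsilon>)) * 2 powr (\<beta> + \<epsilon>)"
      unfolding eq using Suc T1[OF tn1] nonneg by (intro mult_mono) auto
    ultimately show ?case by (simp add: powr_add[symmetric] algebra_simps)
  qed
  \<comment> \<open>L pays for the last factor y in [1,2], the power of 2 for replacing the dyadic
    part of x by x itself, whatever the sign of the exponent.\<close>
  define K where "K = L * 2 powr (\<bar>\<beta>\<bar> + \<epsilon>)"
  have K: "K > 0" using L by (simp add: K_def)
  \<comment> \<open>The reciprocal is bounded as well, so that the case s < t follows by exchanging
    the two arguments.\<close>
  have up: "0 < B (t * x) / B t \<and> B (t * x) / B t \<le> K * x powr (\<beta> + \<epsilon>) \<and> B t / B (t * x) \<le> K * x powr (\<epsilon> - \<beta>)"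
    if t: "t \<ge> T" and x: "x \<ge> 1" for t x
  proof -
    define n where "n = nat \<lfloor>log 2 x\<rfloor>"
    have lx: "log 2 x \<ge> 0" using x by simp
    have n: "real n \<le> log 2 x" "log 2 x < real n + 1" using lx unfolding n_def by linarith+
    define y where "y = x / 2 ^ n"
    have xy: "x = 2 ^ n * y" by (simp add: y_def)
    have "2 powr real n \<le> x" "x < 2 powr (real n + 1)"
      using n x by (simp_all add: le_log_iff log_less_iff)
    then have y: "1 \<le> y" "y \<le> 2" using x by (simp_all add: y_def powr_realpow powr_add field_simps)
    have pw: "2 powr (real n * p) \<le> x powr p * 2 powr (\<bar>\<beta>\<bar> + \<epsilon>)" if p: "\<bar>p\<bar> \<le> \<bar>\<beta>\<bar> + \<epsilon>" for p
    proof -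
      have "2 powr (real n * p) = (2 ^ n) powr p"
        by (simp add: powr_powr flip: powr_realpow)
      also have "\<dots> = x powr p * y powr (-p)"
        using y by (simp add: xy powr_mult powr_minus)
      also have "y powr (-p) \<le> y powr (\<bar>\<beta>\<bar> + \<epsilon>)" using y p by (intro powr_mono) auto
      also have "y powr (\<bar>\<beta>\<bar> + \<epsilon>) \<le> 2 powr (\<bar>\<beta>\<bar> + \<epsilon>)" using y e by (intro powr_mono2) auto
      finally show ?thesis by (simp add: mult_left_mono)
    qed
    have tn: "t * 2 ^ n \<ge> T" using t T by (intro le_mult_one_le) auto
    define u v where "u = B (t * 2 ^ n) / B t" and "v = B (t * 2 ^ n * y) / B (t * 2 ^ n)"
    have eq: "B (t * x) / B t = u * v"
      using B0[OF tn] by (simp add: u_def v_def xy mult_ac)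
    have v: "1 / L < v" "v < L" using L(2)[of "t * 2 ^ n" y] tn y by (auto simp: v_def T_def)
    have vp: "v > 0" using v L by (meson less_trans zero_less_divide_1_iff zero_less_one)
    have u: "2 powr (real n * (\<beta> - \<epsilon>)) \<le> u" "u \<le> 2 powr (real n * (\<beta> + \<epsilon>))"
      using dyadic[OF t] by (auto simp: u_def)
    have up: "u > 0" using u(1) by (rule less_le_trans[rotated]) simp
    have "u * v \<le> (x powr (\<beta> + \<epsilon>) * 2 powr (\<bar>\<beta>\<bar> + \<epsilon>)) * L"
      using order_trans[OF u(2) pw[of "\<beta> + \<epsilon>"]] v up vp e by (intro mult_mono) auto
    moreover have "B t / B (t * x) \<le> K * x powr (\<epsilon> - \<beta>)"
    proof -
      have "1 / u \<le> 1 / 2 powr (real n * (\<beta> - \<epsilon>))" using u(1) up by (intro divide_left_mono) auto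
      also have "\<dots> = 2 powr (real n * (\<epsilon> - \<beta>))" by (simp add: powr_minus_divide[symmetric] algebra_simps)
      also have "\<dots> \<le> x powr (\<epsilon> - \<beta>) * 2 powr (\<bar>\<beta>\<bar> + \<epsilon>)" using e by (intro pw) auto
      finally have "1 / u \<le> x powr (\<epsilon> - \<beta>) * 2 powr (\<bar>\<beta>\<bar> + \<epsilon>)" .
      moreover have "1 / v \<le> L" using v(1) vp L(1) by (simp add: field_simps)
      ultimately have "(1 / u) * (1 / v) \<le> (x powr (\<epsilon> - \<beta>) * 2 powr (\<bar>\<beta>\<bar> + \<epsilon>)) * L"
        using vp by (intro mult_mono) auto
      moreover have "B t / B (t * x) = 1 / (B (t * x) / B t)" by simp
      ultimately show ?thesis unfolding eq K_def by (simp add: mult_ac)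
    qed
    moreover have "0 < u * v" using up vp by simp
    ultimately show ?thesis unfolding eq K_def by (simp add: mult_ac)
  qed
  have "0 < B s / B t \<and> B s / B t \<le> K * ((s / t) powr (\<beta> + \<epsilon>) + (s / t) powr (\<beta> - \<epsilon>))"
    if st: "s \<ge> T" "t \<ge> T" for s t
  proof (cases "s \<ge> t")
    case True
    have "0 < B s / B t \<and> B s / B t \<le> K * (s / t) powr (\<beta> + \<epsilon>)"
      using up[OF st(2), of "s / t"] True st T by simp
    moreover have "K * (s / t) powr (\<beta> - \<epsilon>) \<ge> 0" using K by simp
    ultimately show ?thesis by (simp add: distrib_left)
  next
    case False
    have "0 < B t / B s \<and> B s / B t \<le> K * (t / s) powr (\<epsilon> - \<beta>)"
      using up[OF st(1), of "t / s"] False st T by simp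
    moreover have "(t / s) powr (\<epsilon> - \<beta>) = (s / t) powr (\<beta> - \<epsilon>)"
      using st T by (simp add: powr_divide powr_diff field_simps)
    moreover have "K * (s / t) powr (\<beta> + \<epsilon>) \<ge> 0" using K by simp
    ultimately show ?thesis by (auto simp: distrib_left zero_less_divide_iff)
  qed
  then show ?thesis by (rule that[OF T K])
qed

section \<open>The Abelian theorem\<close>

text \<open>The integral runs over the whole line and omits the prefactor of
  \<open>LS_transform\<close>. Functions on the half-line enter it extended by zero, so affine
  substitution and linearity apply without any bookkeeping of domains.\<close>

definition laplace :: "(real \<Rightarrow> real) \<Rightarrow> real \<Rightarrow> real" where
  "laplace g \<theta> = (\<integral>t. exp (- (\<theta> * t)) * g t \<partial>lebesgue)"

lemma borel_measurable_scale [measurable (raw)]: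
  fixes g :: "real \<Rightarrow> real"
  assumes "g \<in> borel_measurable lebesgue"
  shows "(\<lambda>s. g (l * s)) \<in> borel_measurable lebesgue"
  using measurable_compose[OF lebesgue_measurable_scaling[of l] assms] by (simp only: real_scaleR_def)

lemma borel_measurable_lebesgueI [measurable (raw)]:
  "f \<in> borel_measurable borel \<Longrightarrow> f \<in> borel_measurable lebesgue"
  by (rule measurable_completion) simp

lemma laplace_scale:
  assumes l: "l > 0"
  shows "integrable lebesgue (\<lambda>t. exp (- (\<theta> / l * t)) * g t) \<longleftrightarrow>
      integrable lebesgue (\<lambda>s. exp (- (\<theta> * s)) * g (l * s))"
    and "(\<integral>s. exp (- (\<theta> * s)) * g (l * s) \<partial>lebesgue) = laplace g (\<theta> / l) / l"
proof -
  have eq: "exp (- (\<theta> / l * (0 + l * s))) * g (0 + l * s) = exp (- (\<theta> * s)) * g (l * s)" for s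
    using l by simp
  show "integrable lebesgue (\<lambda>t. exp (- (\<theta> / l * t)) * g t) \<longleftrightarrow>
      integrable lebesgue (\<lambda>s. exp (- (\<theta> * s)) * g (l * s))"
    using lebesgue_integrable_real_affine_iff[of l "\<lambda>t. exp (- (\<theta> / l * t)) * g t" 0] l
    unfolding eq by simp
  show "(\<integral>s. exp (- (\<theta> * s)) * g (l * s) \<partial>lebesgue) = laplace g (\<theta> / l) / l"
    using lebesgue_integral_real_affine[of l "\<lambda>t. exp (- (\<theta> / l * t)) * g t" 0] l
    unfolding eq laplace_def by simp
qed

lemma LS_transform_eq_laplace:
  "LS_transform F l = l * laplace (\<lambda>t. indicator {0..} t * F t) l"
proof -
  have "LS_transform F l = (\<integral>t. l * (exp (- (l * t)) * (indicator {0..} t * F t)) \<partial>lebesgue)"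
    unfolding LS_transform_def set_lebesgue_integral_def by (simp add: mult_ac)
  then show ?thesis by (simp add: laplace_def)
qed

text \<open>Euler's integral after the substitution of \<theta> * t. It starts out as a gauge
  integral, and nonnegativity of the integrand turns it into a Lebesgue integral.\<close>

lemma has_bochner_integral_exp_powr:
  fixes p \<theta> :: real
  assumes p: "p > -1" and \<theta>: "\<theta> > 0"
  shows "has_bochner_integral lebesgue (\<lambda>t. exp (- (\<theta> * t)) * (indicator {0..} t * t powr p))
     (Gamma (p + 1) * \<theta> powr (- p - 1))"
proof -
  have hi: "((\<lambda>t. t powr p / exp t) has_integral Gamma (p + 1)) {0..}"
    using Gamma_integral_real[of "p + 1"] p by simp
  have ai: "(\<lambda>t. t powr p / exp t) absolutely_integrable_on {0..}"
    by (rule nonnegative_absolutely_integrable_1) (use hi in auto)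
  have "(LINT t:{0..}|lebesgue. t powr p / exp t) = Gamma (p + 1)"
    using set_lebesgue_integral_eq_integral(2)[OF ai] integral_unique[OF hi] by simp
  with ai have "has_bochner_integral lebesgue (\<lambda>t. indicator {0..} t *\<^sub>R (t powr p / exp t)) (Gamma (p + 1))"
    by (simp add: has_bochner_integral_iff set_integrable_def set_lebesgue_integral_def)
  then have "has_bochner_integral lebesgue (\<lambda>t. indicator {0..} (0 + \<theta> * t) *\<^sub>R ((0 + \<theta> * t) powr p / exp (0 + \<theta> * t)))
      (Gamma (p + 1) /\<^sub>R \<bar>\<theta>\<bar>)"
    using \<theta> by (subst (asm) has_bochner_integral_lebesgue_real_affine_iff[of \<theta> _ _ 0]) auto
  then have fin: "has_bochner_integral lebesgue (\<lambda>t. \<theta> powr (-p) * (indicator {0..} (0 + \<theta> * t) *\<^sub>R ((0 + \<theta> * t) powr p / exp (0 + \<theta> * t))))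
      (\<theta> powr (-p) * (Gamma (p + 1) /\<^sub>R \<bar>\<theta>\<bar>))"
    by (rule has_bochner_integral_mult_right)
  have eq1: "\<theta> powr (-p) * (indicator {0..} (0 + \<theta> * t) *\<^sub>R ((0 + \<theta> * t) powr p / exp (0 + \<theta> * t)))
     = exp (- (\<theta> * t)) * (indicator {0..} t * t powr p)" for t
    using \<theta> by (auto simp: indicator_def zero_le_mult_iff powr_mult powr_minus exp_minus field_simps)
  have eq2: "\<theta> powr (-p) * (Gamma (p + 1) /\<^sub>R \<bar>\<theta>\<bar>) = Gamma (p + 1) * \<theta> powr (- p - 1)"
    using \<theta> by (simp add: powr_diff powr_minus field_simps)
  show ?thesis using fin unfolding eq1 eq2 .
qed

text \<open>An integrable head of g contributes only O(1) to the Laplace integral, so this is what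
  makes it negligible against \<open>l * B l\<close>. The Potter bound is used with its numerator
  argument frozen at T; \<epsilon> is half the distance of \<beta> from -1.\<close>

lemma RV_inf_inverse_tendsto_0:
  assumes B: "B \<in> RV_inf \<beta>" and \<beta>: "\<beta> > -1"
  shows "((\<lambda>l. 1 / (l * B l)) \<longlongrightarrow> 0) at_top"
proof -
  define \<epsilon> where "\<epsilon> = (\<beta> + 1) / 2"
  have \<epsilon>: "\<epsilon> > 0" "\<beta> - \<epsilon> > -1" "\<beta> + \<epsilon> > -1" using \<beta> by (auto simp: \<epsilon>_def field_simps)
  obtain T K where T: "T > 0" and K: "K > 0" and PK: "\<And>s t. s \<ge> T \<Longrightarrow> t \<ge> T \<Longrightarrow> 0 < B s / B t \<and>
       B s / B t \<le> K * ((s / t) powr (\<beta> + \<epsilon>) + (s / t) powr (\<beta> - \<epsilon>))"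
    using potter_bounds[OF B \<epsilon>(1)] by metis
  have B0: "B T \<noteq> 0" using PK[of T T] by auto
  have lim: "((\<lambda>l. T powr p * l powr (- p - 1)) \<longlongrightarrow> 0) at_top" if "p > -1" for p
    using that by (intro tendsto_mult_right_zero tendsto_neg_powr filterlim_ident) auto
  have "((\<lambda>l. (K / \<bar>B T\<bar>) * (T powr (\<beta> + \<epsilon>) * l powr (- (\<beta> + \<epsilon>) - 1) + T powr (\<beta> - \<epsilon>) * l powr (- (\<beta> - \<epsilon>) - 1)))
      \<longlongrightarrow> (K / \<bar>B T\<bar>) * (0 + 0)) at_top"
    by (intro tendsto_mult tendsto_const tendsto_add lim \<epsilon>)
  then have "((\<lambda>l. (K / \<bar>B T\<bar>) * (T powr (\<beta> + \<epsilon>) * l powr (- (\<beta> + \<epsilon>) - 1) + T powr (\<beta> - \<epsilon>) * l powr (- (\<beta> - \<epsilon>) - 1)))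
      \<longlongrightarrow> 0) at_top" by simp
  then show ?thesis
  proof (rule Lim_null_comparison[rotated])
    show "\<forall>\<^sub>F l in at_top. norm (1 / (l * B l)) \<le> (K / \<bar>B T\<bar>) * (T powr (\<beta> + \<epsilon>) * l powr (- (\<beta> + \<epsilon>) - 1) + T powr (\<beta> - \<epsilon>) * l powr (- (\<beta> - \<epsilon>) - 1))"
      using eventually_ge_at_top[of T]
    proof eventually_elim
      case (elim l)
      have l: "l > 0" using elim T by simp
      have pw: "(T / l) powr p / l = T powr p * l powr (- p - 1)" for p
        using l T by (simp add: powr_divide powr_diff powr_minus field_simps)
      have "B T / B l \<le> K * ((T / l) powr (\<beta> + \<epsilon>) + (T / l) powr (\<beta> - \<epsilon>))" "0 < B T / B l"
        using PK[of T l] elim by auto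
      then have "\<bar>B T / B l\<bar> / (\<bar>B T\<bar> * l) \<le> (K * ((T / l) powr (\<beta> + \<epsilon>) + (T / l) powr (\<beta> - \<epsilon>))) / (\<bar>B T\<bar> * l)"
        using l by (intro divide_right_mono) auto
      moreover have "\<bar>B T / B l\<bar> / (\<bar>B T\<bar> * l) = norm (1 / (l * B l))"
        using B0 l by (simp add: abs_divide abs_mult field_simps)
      moreover have "(K * ((T / l) powr (\<beta> + \<epsilon>) + (T / l) powr (\<beta> - \<epsilon>))) / (\<bar>B T\<bar> * l)
         = (K / \<bar>B T\<bar>) * ((T / l) powr (\<beta> + \<epsilon>) / l + (T / l) powr (\<beta> - \<epsilon>) / l)"
        by (simp add: add_divide_distrib distrib_left)
      ultimately show ?case unfolding pw by linarith
    qed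
  qed
qed

text \<open>The substitution t = l * s turns the quotient into the integral of
  \<open>exp (- s) * g (l * s) / B l\<close>, whose integrand tends to
  \<open>c * exp (- s) * s powr \<beta>\<close>. Nothing is asked of the sign of g, and c may be 0;
  the latter case is used to discard heads.\<close>

lemma laplace_abelian:
  fixes g B :: "real \<Rightarrow> real"
  assumes g[measurable]: "g \<in> borel_measurable lebesgue" and g0: "\<And>t. t < 0 \<Longrightarrow> g t = 0"
    and g_int: "\<And>T. integrable lebesgue (\<lambda>t. indicator {..T} t * g t)"
    and B: "B \<in> RV_inf \<beta>" and \<beta>: "\<beta> > -1"
    and lim: "((\<lambda>t. g t / B t) \<longlongrightarrow> c) at_top"
  shows "\<theta> > 0 \<Longrightarrow> integrable lebesgue (\<lambda>t. exp (- (\<theta> * t)) * g t)"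
    and "((\<lambda>l. laplace g (1 / l) / (l * B l)) \<longlongrightarrow> c * Gamma (\<beta> + 1)) at_top"
proof -
  \<comment> \<open>The Potter exponents with \<epsilon> = (\<beta> + 1) / 2. Both exceed -1, so the
    majorant is integrable at 0; the factor \<open>exp (- s)\<close> takes care of infinity.\<close>
  define p q where "p = \<beta> + (\<beta> + 1) / 2" and "q = \<beta> - (\<beta> + 1) / 2"
  have \<epsilon>: "(\<beta> + 1) / 2 > 0" and pq: "p > -1" "q > -1" using \<beta> by (auto simp: p_def q_def field_simps)
  obtain T0 K where T0: "T0 > 0" and K: "K > 0" and PK: "\<And>s t. s \<ge> T0 \<Longrightarrow> t \<ge> T0 \<Longrightarrow> 0 < B s / B t \<and>
       B s / B t \<le> K * ((s / t) powr p + (s / t) powr q)"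
    unfolding p_def q_def using potter_bounds[OF B \<epsilon>] by metis
  have "\<forall>\<^sub>F t in at_top. \<bar>g t / B t\<bar> < \<bar>c\<bar> + 1"
    using tendsto_rabs[OF lim] by (rule order_tendstoD) simp
  then obtain T1 where T1: "\<And>t. t \<ge> T1 \<Longrightarrow> \<bar>g t / B t\<bar> < \<bar>c\<bar> + 1"
    unfolding eventually_at_top_linorder by blast
  define T where "T = max T0 T1"
  define M where "M = (\<bar>c\<bar> + 1) * K"
  have T: "T > 0" using T0 by (simp add: T_def)
  have M: "M > 0" using K by (simp add: M_def)
  have bound: "\<bar>g s / B t\<bar> \<le> M * ((s / t) powr p + (s / t) powr q)" if "s \<ge> T" "t \<ge> T" for s t
  proof -
    have "B s \<noteq> 0" using PK[of s s] that by (auto simp: T_def)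
    then have "\<bar>g s / B t\<bar> = \<bar>g s / B s\<bar> * \<bar>B s / B t\<bar>" by (simp add: abs_mult)
    also have "\<dots> \<le> (\<bar>c\<bar> + 1) * (K * ((s / t) powr p + (s / t) powr q))"
      using T1[of s] PK[of s t] that by (intro mult_mono) (auto simp: T_def)
    finally show ?thesis by (simp add: M_def)
  qed
  have BT: "B T \<noteq> 0" using PK[of T T] by (auto simp: T_def)
  have int_pw: "integrable lebesgue (\<lambda>t. exp (- (\<theta> * t)) * (indicator {0..} t * t powr r))"
    if "r > -1" "\<theta> > 0" for r \<theta> :: real
    using has_bochner_integral_exp_powr[OF that] by (simp add: has_bochner_integral_iff)
  show int: "integrable lebesgue (\<lambda>t. exp (- (\<theta> * t)) * g t)" if \<theta>: "\<theta> > 0" for \<theta>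
  proof (rule Bochner_Integration.integrable_bound)
    define w where "w t = \<bar>indicator {..T} t * g t\<bar> + 
       (\<bar>B T\<bar> * M) * ((1 / T) powr p * (exp (- (\<theta> * t)) * (indicator {0..} t * t powr p)) + (1 / T) powr q * (exp (- (\<theta> * t)) * (indicator {0..} t * t powr q)))" for t
    show "integrable lebesgue w" unfolding w_def
      by (intro Bochner_Integration.integrable_add integrable_abs g_int integrable_mult_right int_pw pq \<theta>)
    show "(\<lambda>t. exp (- (\<theta> * t)) * g t) \<in> borel_measurable lebesgue" by measurable
    show "AE t in lebesgue. norm (exp (- (\<theta> * t)) * g t) \<le> norm (w t)"
    proof (rule AE_I2)
      fix t
      have w0: "\<bar>indicator {..T} t * g t\<bar> \<le> w t" using M unfolding w_def by simp
      have "norm (exp (- (\<theta> * t)) * g t) \<le> w t"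
      proof (cases "t \<le> T")
        case True
        have "norm (exp (- (\<theta> * t)) * g t) \<le> 1 * \<bar>g t\<bar>"
        proof (cases "t \<ge> 0")
          case True
          then have "exp (- (\<theta> * t)) \<le> 1" using \<theta> by simp
          then show ?thesis unfolding real_norm_def abs_mult by (intro mult_right_mono) auto
        qed (simp add: g0)
        then show ?thesis using w0 True by simp
      next
        case False
        have "\<bar>g t\<bar> = \<bar>B T\<bar> * \<bar>g t / B T\<bar>" using BT by simp
        also have "\<dots> \<le> \<bar>B T\<bar> * (M * ((t / T) powr p + (t / T) powr q))"
          using bound[of t T] False by (intro mult_left_mono) auto
        finally have "exp (- (\<theta> * t)) * \<bar>g t\<bar> \<le> exp (- (\<theta> * t)) * (\<bar>B T\<bar> * (M * ((t / T) powr p + (t / T) powr q)))"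
          by (intro mult_left_mono) auto
        also have "\<dots> = w t" using False T
          by (simp add: w_def powr_divide) (simp add: field_simps)
        finally show ?thesis by (simp add: abs_mult)
      qed
      then show "norm (exp (- (\<theta> * t)) * g t) \<le> norm (w t)" by simp
    qed
  qed
  \<comment> \<open>Potter bounds are valid only when both arguments are at least T. For fixed l the
    points s with l * s below T would escape the majorant, so this head is estimated by its L1 norm
    instead.\<close>
  define g1 g2 where "g1 t = indicator {..T} t * g t" and "g2 t = indicator {T<..} t * g t" for t
  have [measurable]: "g1 \<in> borel_measurable lebesgue" "g2 \<in> borel_measurable lebesgue"
    unfolding g1_def[abs_def] g2_def[abs_def] by measurable
  have g12: "g t = g1 t + g2 t" for t by (auto simp: g1_def g2_def indicator_def)
  have int12: "integrable lebesgue (\<lambda>t. exp (- (\<theta> * t)) * g1 t)" "integrable lebesgue (\<lambda>t. exp (- (\<theta> * t)) * g2 t)"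
    if "\<theta> > 0" for \<theta>
    by (rule Bochner_Integration.integrable_bound[OF int[OF that]];
        simp add: g1_def g2_def indicator_def AE_I2)+
  define N where "N = (\<integral>t. \<bar>g1 t\<bar> \<partial>lebesgue)"
  have ig1: "integrable lebesgue g1" using g_int[of T] by (simp add: g1_def[abs_def])
  have l1: "((\<lambda>l. laplace g1 (1 / l) / (l * B l)) \<longlongrightarrow> 0) at_top"
  proof (rule Lim_null_comparison)
    show "((\<lambda>l. N * \<bar>1 / (l * B l)\<bar>) \<longlongrightarrow> 0) at_top"
      using tendsto_mult_right_zero[OF tendsto_rabs_zero[OF RV_inf_inverse_tendsto_0[OF B \<beta>]]] .
    show "\<forall>\<^sub>F l in at_top. norm (laplace g1 (1 / l) / (l * B l)) \<le> N * \<bar>1 / (l * B l)\<bar>"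
      using eventually_gt_at_top[of 0]
    proof eventually_elim
      case (elim l)
      have "\<bar>laplace g1 (1 / l)\<bar> \<le> N" unfolding laplace_def N_def
      proof (rule order_trans[OF integral_abs_bound integral_mono])
        show "integrable lebesgue (\<lambda>t. \<bar>exp (- (1 / l * t)) * g1 t\<bar>)"
          using int12(1)[of "1 / l"] elim by (intro integrable_abs) simp
        show "integrable lebesgue (\<lambda>t. \<bar>g1 t\<bar>)" by (intro integrable_abs ig1)
        show "\<bar>exp (- (1 / l * t)) * g1 t\<bar> \<le> \<bar>g1 t\<bar>" for t
        proof (cases "t \<ge> 0")
          case True
          then have "exp (- (1 / l * t)) \<le> 1" using elim by simp
          then show ?thesis unfolding abs_mult using mult_right_mono[of "exp (- (1 / l * t))" 1 "\<bar>g1 t\<bar>"] by simp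
        qed (simp add: g1_def g0)
      qed
      then show ?case by (simp add: abs_divide divide_right_mono)
    qed
  qed
  have l2: "((\<lambda>l. \<integral>s. exp (- (1 * s)) * g2 (l * s) / B l \<partial>lebesgue)
     \<longlongrightarrow> (\<integral>s. c * (exp (- (1 * s)) * (indicator {0..} s * s powr \<beta>)) \<partial>lebesgue)) at_top"
  proof (rule integral_dominated_convergence_at_top)
    show "integrable lebesgue (\<lambda>s. M * (exp (- (1 * s)) * (indicator {0..} s * s powr p) + exp (- (1 * s)) * (indicator {0..} s * s powr q)))"
      using int_pw[OF pq(1), of 1] int_pw[OF pq(2), of 1]
      by (intro integrable_mult_right Bochner_Integration.integrable_add) auto
    show "(\<lambda>s. c * (exp (- (1 * s)) * (indicator {0..} s * s powr \<beta>))) \<in> borel_measurable lebesgue"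
      by measurable
    show "(\<lambda>s. exp (- (1 * s)) * g2 (l * s) / B l) \<in> borel_measurable lebesgue" for l by measurable
    show "AE s in lebesgue. ((\<lambda>l. exp (- (1 * s)) * g2 (l * s) / B l)
       \<longlongrightarrow> c * (exp (- (1 * s)) * (indicator {0..} s * s powr \<beta>))) at_top"
    proof (rule AE_I2)
      fix s :: real
      show "((\<lambda>l. exp (- (1 * s)) * g2 (l * s) / B l)
         \<longlongrightarrow> c * (exp (- (1 * s)) * (indicator {0..} s * s powr \<beta>))) at_top"
      proof (cases "s > 0")
        case True
        note fs = filterlim_at_top_mult_const[OF True]
        have "((\<lambda>l. exp (- (1 * s)) * (g (l * s) / B (l * s) * (B (l * s) / B l)))
          \<longlongrightarrow> exp (- (1 * s)) * (c * s powr \<beta>)) at_top"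
          by (intro tendsto_mult tendsto_const filterlim_compose[OF lim fs] RV_infD(1)[OF B True])
        moreover have "\<forall>\<^sub>F l in at_top. exp (- (1 * s)) * (g (l * s) / B (l * s) * (B (l * s) / B l)) = exp (- (1 * s)) * g2 (l * s) / B l"
          using fs[unfolded filterlim_iff, rule_format, OF eventually_gt_at_top[of T]]
            fs[unfolded filterlim_iff, rule_format, OF RV_infD(2)[OF B]]
          by eventually_elim (simp add: g2_def)
        ultimately show ?thesis using True by (simp add: tendsto_cong mult_ac)
      next
        \<comment> \<open>At s = 0 the proposed limit vanishes as well, since
          \<open>0 powr \<beta>\<close> is 0 for every \<beta>.\<close>
        case False
        have "\<forall>\<^sub>F l in at_top. exp (- (1 * s)) * g2 (l * s) / B l = 0"
          using eventually_gt_at_top[of 0]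
        proof eventually_elim
          case (elim l)
          then have "l * s \<le> 0" using False by (simp add: mult_le_0_iff)
          then show ?case using T by (simp add: g2_def)
        qed
        then show ?thesis using False by (cases "s = 0") (auto simp: tendsto_eventually)
      qed
    qed
    show "\<forall>\<^sub>F l in at_top. AE s in lebesgue. norm (exp (- (1 * s)) * g2 (l * s) / B l)
        \<le> M * (exp (- (1 * s)) * (indicator {0..} s * s powr p) + exp (- (1 * s)) * (indicator {0..} s * s powr q))"
      using eventually_ge_at_top[of T]
    proof (eventually_elim, intro AE_I2)
      fix l s assume l: "l \<ge> T"
      show "norm (exp (- (1 * s)) * g2 (l * s) / B l)
        \<le> M * (exp (- (1 * s)) * (indicator {0..} s * s powr p) + exp (- (1 * s)) * (indicator {0..} s * s powr q))"
      proof (cases "l * s > T")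
        case True
        have s: "s > 0" using True l T by (smt (verit) mult_nonneg_nonpos)
        have "exp (- s) * \<bar>g (l * s) / B l\<bar> \<le> exp (- s) * (M * (((l * s) / l) powr p + ((l * s) / l) powr q))"
          using bound[of "l * s" l] True l by (intro mult_left_mono) auto
        then show ?thesis using True s l T by (simp add: g2_def abs_mult algebra_simps)
      next
        case False
        then show ?thesis using M by (simp add: g2_def)
      qed
    qed
  qed
  have "((\<lambda>l. laplace g2 (1 / l) / (l * B l)) \<longlongrightarrow> c * Gamma (\<beta> + 1)) at_top"
  proof (rule Lim_transform_eventually)
    show "((\<lambda>l. \<integral>s. exp (- (1 * s)) * g2 (l * s) / B l \<partial>lebesgue) \<longlongrightarrow> c * Gamma (\<beta> + 1)) at_top"
      using l2 has_bochner_integral_integral_eq[OF has_bochner_integral_exp_powr[OF \<beta> zero_less_one]] by simp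
    show "\<forall>\<^sub>F l in at_top. (\<integral>s. exp (- (1 * s)) * g2 (l * s) / B l \<partial>lebesgue) = laplace g2 (1 / l) / (l * B l)"
      using eventually_gt_at_top[of 0]
    proof eventually_elim
      case (elim l)
      show ?case using laplace_scale(2)[OF elim, of 1 g2] by simp
    qed
  qed
  from tendsto_add[OF l1 this] have "((\<lambda>l. laplace g1 (1 / l) / (l * B l) + laplace g2 (1 / l) / (l * B l)) \<longlongrightarrow> c * Gamma (\<beta> + 1)) at_top"
    by simp
  then show "((\<lambda>l. laplace g (1 / l) / (l * B l)) \<longlongrightarrow> c * Gamma (\<beta> + 1)) at_top"
  proof (rule Lim_transform_eventually)
    show "\<forall>\<^sub>F l in at_top. laplace g1 (1 / l) / (l * B l) + laplace g2 (1 / l) / (l * B l) = laplace g (1 / l) / (l * B l)"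
      using eventually_gt_at_top[of 0]
    proof eventually_elim
      case (elim l)
      have "laplace g (1 / l) = laplace g1 (1 / l) + laplace g2 (1 / l)"
        unfolding laplace_def g12 distrib_left using int12[of "1 / l"] elim by (intro Bochner_Integration.integral_add) auto
      then show ?case by (simp add: add_divide_distrib)
    qed
  qed
qed

section \<open>The Tauberian theorem with monotone density\<close>

lemma RV_inf_cmult:
  assumes B: "B \<in> RV_inf \<beta>" and k: "k \<noteq> 0"
  shows "(\<lambda>t. k * B t) \<in> RV_inf \<beta>"
proof -
  have "eventually_signed (\<lambda>t. k * B t)"
  proof (cases "k > 0")
    case True
    then show ?thesis using B by (auto simp: RV_inf_def eventually_signed_def zero_less_mult_iff mult_less_0_iff)
  next
    case False
    then have "k < 0" using k by simp
    then show ?thesis using B by (auto simp: RV_inf_def eventually_signed_def zero_less_mult_iff mult_less_0_iff)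
  qed
  moreover have "(\<lambda>t. k * B t) \<in> borel_measurable (lebesgue_on {0<..})"
    by (intro borel_measurable_times borel_measurable_const RV_infD(3)[OF B])
  ultimately show ?thesis using B k unfolding RV_inf_def by simp
qed

section \<open>Karamata's method: continuous test functions approximated by polynomials in
  exp(-s)\<close>

lemma continuous_zero_outside_bounded:
  fixes h :: "real \<Rightarrow> real"
  assumes h: "continuous_on UNIV h" and h0: "\<And>s. s \<notin> {a..b} \<Longrightarrow> h s = 0"
  obtains H where "H > 0" "\<And>s. \<bar>h s\<bar> \<le> H * exp (- s)"
proof -
  \<comment> \<open>Domination by \<open>exp (- s)\<close> is what transfers integrability from the
    Laplace integrand to \<open>h s * g (l * s)\<close>.\<close>
  have "compact ((\<lambda>s. h s * exp s) ` {a..b})"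
    by (intro compact_continuous_image continuous_intros continuous_on_subset[OF h]) auto
  then obtain H where H: "H > 0" "\<And>s. s \<in> {a..b} \<Longrightarrow> norm (h s * exp s) \<le> H"
    by (auto dest!: compact_imp_bounded simp: bounded_pos)
  have "\<bar>h s\<bar> \<le> H * exp (- s)" for s
  proof (cases "s \<in> {a..b}")
    case True
    then show ?thesis using H(2)[of s] by (simp add: abs_mult exp_minus field_simps)
  qed (use H h0 in auto)
  with H(1) show ?thesis by (rule that)
qed

text \<open>Weierstrass approximation of \<open>u \<mapsto> h (- ln u) / u\<close> on the unit interval.\<close>

lemma polynomial_in_exp_approx:
  fixes h :: "real \<Rightarrow> real"
  assumes h: "continuous_on UNIV h" and h0: "\<And>s. s \<notin> {a..b} \<Longrightarrow> h s = 0" and e: "e > 0"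
  obtains n :: nat and k :: "nat \<Rightarrow> real"
    where "\<And>s. s \<ge> 0 \<Longrightarrow> \<bar>h s - (\<Sum>i\<le>n. k i * exp (- (real (Suc i) * s)))\<bar> \<le> e * exp (- s)"
proof -
  \<comment> \<open>Division by u is undone at the end by multiplication with u = exp(-s): the
    uniform error gains the integrable weight \<open>exp (- s)\<close>, and the polynomial loses its
    constant term, hence \<open>Suc i\<close>. Continuity at 0 holds because h vanishes beyond b, so
    P is 0 up to \<open>exp (- (b + 1))\<close>; the extra 1 places -ln u strictly outside
    [a,b].\<close>
  define P where "P u = (if u \<le> 0 then 0 else h (- ln u) / u)" for u :: real
  have "continuous_on {exp (- (b + 1))..1} (\<lambda>u. h (- ln u) / u)"
    by (intro continuous_intros continuous_on_compose2[OF h]) (auto simp: order.strict_trans2[OF exp_gt_zero])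
  then have c1: "continuous_on {exp (- (b + 1))..1} P"
    by (rule continuous_on_eq) (auto simp: P_def dest: order.strict_trans2[OF exp_gt_zero])
  have c2: "continuous_on {..exp (- (b + 1))} P"
  proof (rule continuous_on_eq[OF continuous_on_const[of _ 0]])
    fix u assume u: "u \<in> {..exp (- (b + 1))}"
    show "0 = P u"
    proof (cases "u \<le> 0")
      case False
      then have "ln u \<le> ln (exp (- (b + 1)))" using u by (subst ln_le_cancel_iff) auto
      then have "ln u \<le> - (b + 1)" by simp
      then show ?thesis using h0[of "- ln u"] by (simp add: P_def)
    qed (simp add: P_def)
  qed
  have "continuous_on ({..exp (- (b + 1))} \<union> {exp (- (b + 1))..1}) P"
    by (intro continuous_on_closed_Un c1 c2) auto
  then have "continuous_on {0..1} P" by (rule continuous_on_subset) auto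
  then obtain p where p: "real_polynomial_function p" "\<And>u. u \<in> {0..1} \<Longrightarrow> \<bar>P u - p u\<bar> < e"
    using Stone_Weierstrass_real_polynomial_function[of "{0..1}" P e] e by auto
  then obtain k n where pk: "p = (\<lambda>u. \<Sum>i\<le>n. k i * u ^ i)"
    using real_polynomial_function_iff_sum by blast
  show ?thesis
  proof (rule that[where n = n and k = k])
    fix s :: real assume s: "s \<ge> 0"
    have "\<bar>P (exp (- s)) - p (exp (- s))\<bar> * exp (- s) \<le> e * exp (- s)"
      using p(2)[of "exp (- s)"] s by (intro mult_right_mono) auto
    moreover have "\<bar>P (exp (- s)) - p (exp (- s))\<bar> * exp (- s) = \<bar>(P (exp (- s)) - p (exp (- s))) * exp (- s)\<bar>"
      by (simp add: abs_mult)
    moreover have "P (exp (- s)) * exp (- s) = h s" by (simp add: P_def)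
    moreover have "p (exp (- s)) * exp (- s) = (\<Sum>i\<le>n. k i * exp (- (real (Suc i) * s)))"
    proof -
      have "exp (- s) ^ i * exp (- s) = exp (- (real (Suc i) * s))" for i
        by (simp add: exp_of_nat_mult[symmetric] exp_add[symmetric] algebra_simps)
      then show ?thesis by (simp add: pk sum_distrib_right mult.assoc)
    qed
    ultimately show "\<bar>h s - (\<Sum>i\<le>n. k i * exp (- (real (Suc i) * s)))\<bar> \<le> e * exp (- s)"
      by (simp add: left_diff_distrib)
  qed
qed

text \<open>For the kernels exp(-\<theta> s) the limit is the hypothesis rescaled, and it passes to
  their linear combinations. For general h the approximation error is at most a small multiple of
  \<open>exp (- s) * g (l * s)\<close>, and its integral is controlled by the hypothesis itself;
  this is where g \<ge> 0 enters.\<close>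

lemma karamata_test_function:
  fixes g B h :: "real \<Rightarrow> real"
  assumes g[measurable]: "g \<in> borel_measurable lebesgue" and g0: "\<And>t. t < 0 \<Longrightarrow> g t = 0"
    and g_pos: "\<And>t. g t \<ge> 0"
    and g_int: "\<And>\<theta>. \<theta> > 0 \<Longrightarrow> integrable lebesgue (\<lambda>t. exp (- (\<theta> * t)) * g t)"
    and B: "B \<in> RV_inf \<beta>" and \<beta>: "\<beta> > -1" and B_pos: "\<forall>\<^sub>F t in at_top. B t > 0"
    and lim: "((\<lambda>l. laplace g (1 / l) / (l * B l)) \<longlongrightarrow> c * Gamma (\<beta> + 1)) at_top"
    and h: "continuous_on UNIV h" and h0: "\<And>s. s \<notin> {a..b} \<Longrightarrow> h s = 0"
  shows "((\<lambda>l. (\<integral>s. h s * g (l * s) \<partial>lebesgue) / B l)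
      \<longlongrightarrow> c * (\<integral>s. h s * (indicator {0..} s * s powr \<beta>) \<partial>lebesgue)) at_top"
    and "l > 0 \<Longrightarrow> integrable lebesgue (\<lambda>s. h s * g (l * s))"
    and "integrable lebesgue (\<lambda>s. h s * (indicator {0..} s * s powr \<beta>))"
proof -
  have [measurable]: "h \<in> borel_measurable borel" using h by (rule borel_measurable_continuous_onI)
  define w :: "real \<Rightarrow> real" where "w s = indicator {0..} s * s powr \<beta>" for s
  have [measurable]: "w \<in> borel_measurable borel" unfolding w_def[abs_def] by measurable
  have w0: "w s \<ge> 0" "s < 0 \<Longrightarrow> w s = 0" for s by (auto simp: w_def)
  obtain H where H: "H > 0" "\<And>s. \<bar>h s\<bar> \<le> H * exp (- s)"
    using continuous_zero_outside_bounded[OF h h0] by blast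
  have eg: "integrable lebesgue (\<lambda>s. exp (- (\<theta> * s)) * g (l * s))" if "\<theta> > 0" "l > 0" for \<theta> l
    using g_int[of "\<theta> / l"] that by (subst laplace_scale(1)[symmetric]) auto
  have ew: "integrable lebesgue (\<lambda>s. exp (- (\<theta> * s)) * w s)"
    and ew_eq: "(\<integral>s. exp (- (\<theta> * s)) * w s \<partial>lebesgue) = Gamma (\<beta> + 1) * \<theta> powr (- \<beta> - 1)" if "\<theta> > 0" for \<theta>
    using has_bochner_integral_exp_powr[OF \<beta> that] by (auto simp: w_def has_bochner_integral_iff)
  have hint: "integrable lebesgue (\<lambda>s. h s * v s)"
    if v: "v \<in> borel_measurable lebesgue" "\<And>s. v s \<ge> 0" "integrable lebesgue (\<lambda>s. exp (- (1 * s)) * v s)" for v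
  proof (rule Bochner_Integration.integrable_bound[OF integrable_mult_right[OF v(3), of H]])
    show "(\<lambda>s. h s * v s) \<in> borel_measurable lebesgue" using v(1) by measurable
    show "AE s in lebesgue. norm (h s * v s) \<le> norm (H * (exp (- (1 * s)) * v s))"
    proof (rule AE_I2)
      fix s
      have "\<bar>h s\<bar> * v s \<le> H * exp (- s) * v s" using H(2) v(2) by (intro mult_right_mono)
      then show "norm (h s * v s) \<le> norm (H * (exp (- (1 * s)) * v s))"
        using H(1) v(2)[of s] by (simp add: abs_mult mult_ac)
    qed
  qed
  have hg: "integrable lebesgue (\<lambda>s. h s * g (l * s))" if "l > 0" for l
    using eg[of 1 l] that g_pos by (intro hint) auto
  then show "l > 0 \<Longrightarrow> integrable lebesgue (\<lambda>s. h s * g (l * s))" .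
  have hw: "integrable lebesgue (\<lambda>s. h s * w s)" using ew[of 1] w0 by (intro hint) auto
  then show "integrable lebesgue (\<lambda>s. h s * (indicator {0..} s * s powr \<beta>))" by (simp add: w_def)
  define G where "G = Gamma (\<beta> + 1)"
  have G: "G > 0" unfolding G_def using \<beta> by (intro Gamma_real_pos) auto
  have lim\<theta>: "((\<lambda>l. (\<integral>s. exp (- (\<theta> * s)) * g (l * s) \<partial>lebesgue) / B l)
      \<longlongrightarrow> c * (\<integral>s. exp (- (\<theta> * s)) * w s \<partial>lebesgue)) at_top" if \<theta>: "\<theta> > 0" for \<theta>
  proof -
    have i\<theta>: "1 / \<theta> > 0" using \<theta> by simp
    \<comment> \<open>The hypothesis is read at l / \<theta> instead of l; regular variation of B
      supplies the factor \<theta> to the power -\<beta>.\<close>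
    note fs = filterlim_at_top_mult_const[OF i\<theta>]
    have "((\<lambda>l. laplace g (1 / (l * (1 / \<theta>))) / (l * (1 / \<theta>) * B (l * (1 / \<theta>))) * (1 / \<theta>) * (B (l * (1 / \<theta>)) / B l))
       \<longlongrightarrow> c * Gamma (\<beta> + 1) * (1 / \<theta>) * (1 / \<theta>) powr \<beta>) at_top"
      by (intro tendsto_mult tendsto_const filterlim_compose[OF lim fs] RV_infD(1)[OF B] i\<theta>)
    moreover have "c * Gamma (\<beta> + 1) * (1 / \<theta>) * (1 / \<theta>) powr \<beta> = c * (\<integral>s. exp (- (\<theta> * s)) * w s \<partial>lebesgue)"
      using \<theta> unfolding ew_eq[OF \<theta>] by (simp add: powr_divide powr_diff powr_minus field_simps)
    moreover have "\<forall>\<^sub>F l in at_top. laplace g (1 / (l * (1 / \<theta>))) / (l * (1 / \<theta>) * B (l * (1 / \<theta>))) * (1 / \<theta>) * (B (l * (1 / \<theta>)) / B l)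
       = (\<integral>s. exp (- (\<theta> * s)) * g (l * s) \<partial>lebesgue) / B l"
      using eventually_gt_at_top[of 0] fs[unfolded filterlim_iff, rule_format, OF RV_infD(2)[OF B]]
    proof eventually_elim
      case (elim l)
      show ?case using elim \<theta> by (simp add: laplace_scale(2)[OF elim(1)])
    qed
    ultimately show ?thesis by (simp add: Lim_transform_eventually)
  qed
  have "((\<lambda>l. (\<integral>s. h s * g (l * s) \<partial>lebesgue) / B l) \<longlongrightarrow> c * (\<integral>s. h s * w s \<partial>lebesgue)) at_top"
  proof (rule tendstoI)
    fix e :: real assume e: "e > 0"
    \<comment> \<open>Strictly above the limit of the averages for the kernel exp(-s), hence an
      eventual bound for them. With \<open>d * D = e / 3\<close> there are three errors of size e /
      3: replacing h by p under g, the limit for p, and replacing p by h under the power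
      weight.\<close>
    define D where "D = \<bar>c\<bar> * G + 1"
    have D: "D > 0" using G by (simp add: D_def add_nonneg_pos)
    define d where "d = e / (3 * D)"
    have d: "d > 0" "d * D = e / 3" using e D by (simp_all add: d_def)
    obtain n k where nk: "\<And>s. s \<ge> 0 \<Longrightarrow> \<bar>h s - (\<Sum>i\<le>n. k i * exp (- (real (Suc i) * s)))\<bar> \<le> d * exp (- s)"
      using polynomial_in_exp_approx[OF h h0 d(1)] by blast
    define p where "p s = (\<Sum>i\<le>n. k i * exp (- (real (Suc i) * s)))" for s
    have p_sum: "integrable lebesgue (\<lambda>s. p s * v s)"
      "(\<integral>s. p s * v s \<partial>lebesgue) = (\<Sum>i\<le>n. k i * (\<integral>s. exp (- (real (Suc i) * s)) * v s \<partial>lebesgue))"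
      if v: "\<And>i. integrable lebesgue (\<lambda>s. exp (- (real (Suc i) * s)) * v s)" for v :: "real \<Rightarrow> real"
    proof -
      have eq: "p s * v s = (\<Sum>i\<le>n. k i * (exp (- (real (Suc i) * s)) * v s))" for s
        unfolding p_def sum_distrib_right by (simp add: mult.assoc)
      show "integrable lebesgue (\<lambda>s. p s * v s)"
        unfolding eq by (intro Bochner_Integration.integrable_sum integrable_mult_right v)
      show "(\<integral>s. p s * v s \<partial>lebesgue) = (\<Sum>i\<le>n. k i * (\<integral>s. exp (- (real (Suc i) * s)) * v s \<partial>lebesgue))"
        unfolding eq
        by (simp only: Bochner_Integration.integral_sum[OF integrable_mult_right[OF v]] integral_mult_right_zero)
    qed
    have approx: "\<bar>(\<integral>s. h s * v s \<partial>lebesgue) - (\<integral>s. p s * v s \<partial>lebesgue)\<bar> \<le> d * (\<integral>s. exp (- (1 * s)) * v s \<partial>lebesgue)"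
      if v: "\<And>s. v s \<ge> 0" "\<And>s. s < 0 \<Longrightarrow> v s = 0" "integrable lebesgue (\<lambda>s. h s * v s)"
        "\<And>\<theta>. \<theta> > 0 \<Longrightarrow> integrable lebesgue (\<lambda>s. exp (- (\<theta> * s)) * v s)" for v
    proof -
      have ip: "integrable lebesgue (\<lambda>s. p s * v s)" by (rule p_sum) (use v(4) in auto)
      have "\<bar>(\<integral>s. h s * v s \<partial>lebesgue) - (\<integral>s. p s * v s \<partial>lebesgue)\<bar> = \<bar>\<integral>s. h s * v s - p s * v s \<partial>lebesgue\<bar>"
        by (subst Bochner_Integration.integral_diff[OF v(3) ip]) simp
      also have "\<dots> \<le> (\<integral>s. d * (exp (- (1 * s)) * v s) \<partial>lebesgue)"
      proof (rule order_trans[OF integral_abs_bound integral_mono])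
        show "integrable lebesgue (\<lambda>s. \<bar>h s * v s - p s * v s\<bar>)"
          by (intro integrable_abs Bochner_Integration.integrable_diff v(3) ip)
        show "integrable lebesgue (\<lambda>s. d * (exp (- (1 * s)) * v s))"
          by (intro integrable_mult_right v(4)) simp
        show "\<bar>h s * v s - p s * v s\<bar> \<le> d * (exp (- (1 * s)) * v s)" for s
        proof (cases "s \<ge> 0")
          case True
          have "\<bar>h s - p s\<bar> * v s \<le> d * exp (- s) * v s"
            using nk[OF True] v(1) unfolding p_def by (intro mult_right_mono)
          moreover have "\<bar>h s * v s - p s * v s\<bar> = \<bar>h s - p s\<bar> * v s"
            using v(1)[of s] by (simp add: abs_mult left_diff_distrib[symmetric])
          ultimately show ?thesis by (simp add: mult_ac)
        qed (simp add: v(2))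
      qed
      also have "\<dots> = d * (\<integral>s. exp (- (1 * s)) * v s \<partial>lebesgue)" by simp
      finally show ?thesis .
    qed
    have "((\<lambda>l. \<Sum>i\<le>n. k i * ((\<integral>s. exp (- (real (Suc i) * s)) * g (l * s) \<partial>lebesgue) / B l))
        \<longlongrightarrow> (\<Sum>i\<le>n. k i * (c * (\<integral>s. exp (- (real (Suc i) * s)) * w s \<partial>lebesgue)))) at_top"
      by (intro tendsto_sum tendsto_mult tendsto_const lim\<theta>) simp
    moreover have "(\<Sum>i\<le>n. k i * (c * (\<integral>s. exp (- (real (Suc i) * s)) * w s \<partial>lebesgue))) = c * (\<integral>s. p s * w s \<partial>lebesgue)"
      by (subst p_sum(2)[OF ew]) (auto simp: sum_distrib_left mult_ac simp del: of_nat_Suc)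
    ultimately have lp: "((\<lambda>l. \<Sum>i\<le>n. k i * ((\<integral>s. exp (- (real (Suc i) * s)) * g (l * s) \<partial>lebesgue) / B l))
        \<longlongrightarrow> c * (\<integral>s. p s * w s \<partial>lebesgue)) at_top" by simp
    have ev1: "\<forall>\<^sub>F l in at_top. dist (\<Sum>i\<le>n. k i * ((\<integral>s. exp (- (real (Suc i) * s)) * g (l * s) \<partial>lebesgue) / B l)) (c * (\<integral>s. p s * w s \<partial>lebesgue)) < e / 3"
      using lp e by (intro tendstoD) auto
    have "c * (\<integral>s. exp (- (1 * s)) * w s \<partial>lebesgue) \<le> \<bar>c\<bar> * G"
      using ew_eq[of 1] G by (simp add: G_def mult_right_mono)
    then have "c * (\<integral>s. exp (- (1 * s)) * w s \<partial>lebesgue) < D" by (simp add: D_def)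
    then have ev2: "\<forall>\<^sub>F l in at_top. (\<integral>s. exp (- (1 * s)) * g (l * s) \<partial>lebesgue) / B l < D"
      by (intro order_tendstoD(2)[OF lim\<theta>]) auto
    have W: "\<bar>c * (\<integral>s. h s * w s \<partial>lebesgue) - c * (\<integral>s. p s * w s \<partial>lebesgue)\<bar> \<le> e / 3"
    proof -
      have "\<bar>(\<integral>s. h s * w s \<partial>lebesgue) - (\<integral>s. p s * w s \<partial>lebesgue)\<bar> \<le> d * G"
        using approx[OF w0 hw ew] ew_eq[of 1] by (simp add: G_def)
      then have "\<bar>c\<bar> * \<bar>(\<integral>s. h s * w s \<partial>lebesgue) - (\<integral>s. p s * w s \<partial>lebesgue)\<bar> \<le> \<bar>c\<bar> * (d * G)"
        by (intro mult_left_mono) auto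
      also have "\<dots> \<le> d * D" using d(1) by (simp add: D_def algebra_simps)
      finally show ?thesis by (simp add: d(2) abs_mult[symmetric] right_diff_distrib)
    qed
    show "\<forall>\<^sub>F l in at_top. dist ((\<integral>s. h s * g (l * s) \<partial>lebesgue) / B l) (c * (\<integral>s. h s * w s \<partial>lebesgue)) < e"
      using ev1 ev2 B_pos eventually_gt_at_top[of 0]
    proof eventually_elim
      case (elim l)
      define hi pi where "hi = (\<integral>s. h s * g (l * s) \<partial>lebesgue)" and "pi = (\<integral>s. p s * g (l * s) \<partial>lebesgue)"
      have "\<bar>hi - pi\<bar> \<le> d * (\<integral>s. exp (- (1 * s)) * g (l * s) \<partial>lebesgue)"
        unfolding hi_def pi_def
      proof (rule approx)
        show "g (l * s) = 0" if "s < 0" for s using that elim by (intro g0) (simp add: mult_pos_neg)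
      qed (use g_pos hg eg elim in auto)
      also have "\<dots> \<le> d * (D * B l)" using elim d(1) by (intro mult_left_mono) (auto simp: field_simps)
      also have "\<dots> = e / 3 * B l" using d(2) by simp
      finally have "\<bar>hi - pi\<bar> / B l \<le> e / 3" using elim by (simp add: field_simps)
      then have 1: "\<bar>hi / B l - pi / B l\<bar> \<le> e / 3" using elim by (simp add: diff_divide_distrib[symmetric] abs_divide)
      have "pi / B l = (\<Sum>i\<le>n. k i * ((\<integral>s. exp (- (real (Suc i) * s)) * g (l * s) \<partial>lebesgue) / B l))"
        unfolding pi_def using elim by (subst p_sum(2)[OF eg]) (auto simp: sum_divide_distrib simp del: of_nat_Suc)
      with elim have 2: "\<bar>pi / B l - c * (\<integral>s. p s * w s \<partial>lebesgue)\<bar> < e / 3"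
        by (simp add: dist_real_def)
      show ?case using 1 2 W unfolding dist_real_def hi_def[symmetric] by linarith
    qed
  qed
  then show "((\<lambda>l. (\<integral>s. h s * g (l * s) \<partial>lebesgue) / B l)
      \<longlongrightarrow> c * (\<integral>s. h s * (indicator {0..} s * s powr \<beta>) \<partial>lebesgue)) at_top" by (simp add: w_def)
qed

section \<open>From test functions to pointwise values: tent-shaped averages\<close>

lemma tent_integral:
  fixes m r :: real
  assumes r: "r > 0"
  defines "h \<equiv> \<lambda>s. max 0 (r - \<bar>s - m\<bar>)"
  shows "continuous_on UNIV h" "\<And>s. s \<notin> {m - r..m + r} \<Longrightarrow> h s = 0" "\<And>s. h s \<ge> 0"
    "integrable lebesgue h" "integral\<^sup>L lebesgue h > 0"
proof -
  show c: "continuous_on UNIV h" unfolding h_def by (intro continuous_intros)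
  show h0: "h s = 0" if "s \<notin> {m - r..m + r}" for s using that by (auto simp: h_def abs_if split: if_splits)
  show hp: "h s \<ge> 0" for s by (simp add: h_def)
  have [measurable]: "h \<in> borel_measurable borel" using c by (rule borel_measurable_continuous_onI)
  show int: "integrable lebesgue h"
  proof (rule Bochner_Integration.integrable_bound)
    show "integrable lebesgue (\<lambda>s. r * indicator {m - r..m + r} s)"
      by (intro integrable_mult_right integrable_real_indicator) (auto simp: emeasure_lborel_Icc_eq)
    show "AE s in lebesgue. norm (h s) \<le> norm (r * indicator {m - r..m + r} s)"
      using h0 r by (intro AE_I2) (auto simp: h_def indicator_def)
  qed measurable
  \<comment> \<open>On the inner half of its support the tent is at least r / 2, which makes its
    mass positive.\<close>
  have "0 < r / 2 * measure lebesgue {m - r / 2..m + r / 2}" using r by simp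
  also have "\<dots> = (\<integral>s. r / 2 * indicator {m - r / 2..m + r / 2} s \<partial>lebesgue)" by simp
  also have "\<dots> \<le> integral\<^sup>L lebesgue h"
  proof (rule integral_mono)
    show "integrable lebesgue (\<lambda>s. r / 2 * indicator {m - r / 2..m + r / 2} s)"
      by (intro integrable_mult_right integrable_real_indicator) (auto simp: emeasure_lborel_Icc_eq)
    show "r / 2 * indicator {m - r / 2..m + r / 2} s \<le> h s" for s
      using r by (auto simp: h_def indicator_def abs_if max_def)
  qed (rule int)
  finally show "integral\<^sup>L lebesgue h > 0" .
qed

text \<open>Q is the average of \<open>g (l * s) / B l\<close> against a normalised tent on the
  window around m. Being an average, it is squeezed by any bounds for g on the window; its limit is
  c times the average of \<open>s powr \<beta>\<close>, which is within \<eta> of 1. A tent rather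
  than an indicator is used so that the weight is continuous.\<close>

lemma tent_average:
  fixes g B :: "real \<Rightarrow> real"
  assumes g: "g \<in> borel_measurable lebesgue" and g0: "\<And>t. t < 0 \<Longrightarrow> g t = 0"
    and g_pos: "\<And>t. g t \<ge> 0"
    and g_int: "\<And>\<theta>. \<theta> > 0 \<Longrightarrow> integrable lebesgue (\<lambda>t. exp (- (\<theta> * t)) * g t)"
    and B: "B \<in> RV_inf \<beta>" and \<beta>: "\<beta> > -1" and B_pos: "\<forall>\<^sub>F t in at_top. B t > 0"
    and lim: "((\<lambda>l. laplace g (1 / l) / (l * B l)) \<longlongrightarrow> c * Gamma (\<beta> + 1)) at_top"
    and r: "0 < r" "r < m" and \<eta>: "\<And>s. s \<in> {m - r..m + r} \<Longrightarrow> \<bar>s powr \<beta> - 1\<bar> \<le> \<eta>"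
  obtains Q c' where "(Q \<longlongrightarrow> c') at_top" "\<bar>c' - c\<bar> \<le> \<bar>c\<bar> * \<eta>"
    "\<And>l X. l > 0 \<Longrightarrow> B l > 0 \<Longrightarrow> (\<And>s. s \<in> {m - r..m + r} \<Longrightarrow> g (l * s) \<le> X) \<Longrightarrow> Q l \<le> X / B l"
    "\<And>l X. l > 0 \<Longrightarrow> B l > 0 \<Longrightarrow> (\<And>s. s \<in> {m - r..m + r} \<Longrightarrow> X \<le> g (l * s)) \<Longrightarrow> X / B l \<le> Q l"
proof -
  define h where "h s = max 0 (r - \<bar>s - m\<bar>)" for s
  have tent: "continuous_on UNIV h" "\<And>s. s \<notin> {m - r..m + r} \<Longrightarrow> h s = 0" "\<And>s. h s \<ge> 0"
    "integrable lebesgue h" "integral\<^sup>L lebesgue h > 0"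
    unfolding h_def[abs_def] by (rule tent_integral[OF r(1)], assumption?)+
  define N where "N = integral\<^sup>L lebesgue h"
  have N: "N > 0" using tent(5) by (simp add: N_def)
  define w :: "real \<Rightarrow> real" where "w s = indicator {0..} s * s powr \<beta>" for s
  have kar: "((\<lambda>l. (\<integral>s. h s * g (l * s) \<partial>lebesgue) / B l) \<longlongrightarrow> c * (\<integral>s. h s * w s \<partial>lebesgue)) at_top"
    "\<And>l. l > 0 \<Longrightarrow> integrable lebesgue (\<lambda>s. h s * g (l * s))"
    "integrable lebesgue (\<lambda>s. h s * w s)"
    unfolding w_def using karamata_test_function[OF g g0 g_pos g_int B \<beta> B_pos lim tent(1) tent(2)] by blast+
  define Q where "Q l = (\<integral>s. h s * g (l * s) \<partial>lebesgue) / B l / N" for l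
  define c' where "c' = c * (\<integral>s. h s * w s \<partial>lebesgue) / N"
  show ?thesis
  proof (rule that)
    show "(Q \<longlongrightarrow> c') at_top" unfolding Q_def[abs_def] c'_def using N by (intro tendsto_divide kar(1) tendsto_const) auto
    have "\<bar>(\<integral>s. h s * w s \<partial>lebesgue) - N\<bar> = \<bar>\<integral>s. h s * w s - h s \<partial>lebesgue\<bar>"
      unfolding N_def using kar(3) tent(4) by (subst Bochner_Integration.integral_diff) auto
    also have "\<dots> \<le> (\<integral>s. \<eta> * h s \<partial>lebesgue)"
    proof (rule order_trans[OF integral_abs_bound integral_mono])
      show "integrable lebesgue (\<lambda>s. \<bar>h s * w s - h s\<bar>)" using kar(3) tent(4) by auto
      show "integrable lebesgue (\<lambda>s. \<eta> * h s)" using tent(4) by simp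
      show "\<bar>h s * w s - h s\<bar> \<le> \<eta> * h s" for s
      proof (cases "s \<in> {m - r..m + r}")
        case True
        then have "h s * w s - h s = h s * (s powr \<beta> - 1)" using r by (simp add: w_def right_diff_distrib)
        then have "\<bar>h s * w s - h s\<bar> = h s * \<bar>s powr \<beta> - 1\<bar>" using tent(3)[of s] by (simp add: abs_mult)
        also have "\<dots> \<le> h s * \<eta>" using tent(3) \<eta>[OF True] by (intro mult_left_mono)
        finally show ?thesis by (simp add: mult.commute)
      qed (simp add: tent(2))
    qed
    also have "\<dots> = \<eta> * N" by (simp add: N_def)
    finally have "\<bar>(\<integral>s. h s * w s \<partial>lebesgue) - N\<bar> / N \<le> \<eta>" using N by (simp add: field_simps)
    then have "\<bar>c\<bar> * (\<bar>(\<integral>s. h s * w s \<partial>lebesgue) - N\<bar> / N) \<le> \<bar>c\<bar> * \<eta>" by (intro mult_left_mono) auto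
    moreover have "c' - c = c * (((\<integral>s. h s * w s \<partial>lebesgue) - N) / N)" using N by (simp add: c'_def field_simps)
    ultimately show "\<bar>c' - c\<bar> \<le> \<bar>c\<bar> * \<eta>" using N by (simp add: abs_mult abs_divide)
    show "Q l \<le> X / B l" if l: "l > 0" "B l > 0" and X: "\<And>s. s \<in> {m - r..m + r} \<Longrightarrow> g (l * s) \<le> X" for l X
    proof -
      have "(\<integral>s. h s * g (l * s) \<partial>lebesgue) \<le> (\<integral>s. X * h s \<partial>lebesgue)"
      proof (rule integral_mono[OF kar(2)[OF l(1)]])
        show "integrable lebesgue (\<lambda>s. X * h s)" using tent(4) by simp
        show "h s * g (l * s) \<le> X * h s" for s
          using X[of s] tent(3)[of s] tent(2)[of s] by (cases "s \<in> {m - r..m + r}") (auto simp: mult.commute[of X] intro: mult_left_mono)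
      qed
      also have "\<dots> = X * N" by (simp add: N_def)
      finally show ?thesis using l N by (simp add: Q_def field_simps)
    qed
    show "X / B l \<le> Q l" if l: "l > 0" "B l > 0" and X: "\<And>s. s \<in> {m - r..m + r} \<Longrightarrow> X \<le> g (l * s)" for l X
    proof -
      have "X * N = (\<integral>s. X * h s \<partial>lebesgue)" by (simp add: N_def)
      also have "\<dots> \<le> (\<integral>s. h s * g (l * s) \<partial>lebesgue)"
      proof (rule integral_mono[OF _ kar(2)[OF l(1)]])
        show "integrable lebesgue (\<lambda>s. X * h s)" using tent(4) by simp
        show "X * h s \<le> h s * g (l * s)" for s
          using X[of s] tent(3)[of s] tent(2)[of s] by (cases "s \<in> {m - r..m + r}") (auto simp: mult.commute[of X] intro: mult_left_mono)
      qed
      finally show ?thesis using l N by (simp add: Q_def field_simps)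
    qed
  qed
qed

text \<open>Monotonicity places \<open>g l / B l\<close> between its averages over a window just
  left of l and one just right of l, and both averages converge to values close to c.\<close>

lemma tauberian_monotone_nonneg:
  fixes g B :: "real \<Rightarrow> real"
  assumes g: "g \<in> borel_measurable lebesgue" and g0: "\<And>t. t < 0 \<Longrightarrow> g t = 0"
    and g_pos: "\<And>t. g t \<ge> 0"
    and g_int: "\<And>\<theta>. \<theta> > 0 \<Longrightarrow> integrable lebesgue (\<lambda>t. exp (- (\<theta> * t)) * g t)"
    and B: "B \<in> RV_inf \<beta>" and \<beta>: "\<beta> > -1" and B_pos: "\<forall>\<^sub>F t in at_top. B t > 0"
    and lim: "((\<lambda>l. laplace g (1 / l) / (l * B l)) \<longlongrightarrow> c * Gamma (\<beta> + 1)) at_top"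
    and mono: "mono_on {T..} g \<or> antimono_on {T..} g"
  shows "((\<lambda>t. g t / B t) \<longlongrightarrow> c) at_top"
proof (rule tendstoI)
  fix e :: real assume e: "e > 0"
  \<comment> \<open>The summand 1 keeps the definition meaningful for c = 0.\<close>
  define \<eta> where "\<eta> = e / (2 * (\<bar>c\<bar> + 1))"
  have \<eta>: "\<eta> > 0" using e by (simp add: \<eta>_def)
  have c\<eta>: "\<bar>c\<bar> * \<eta> < e"
  proof -
    have "\<bar>c\<bar> * \<eta> \<le> (\<bar>c\<bar> + 1) * \<eta>" using \<eta> by (intro mult_right_mono) auto
    also have "\<dots> = e / 2" by (simp add: \<eta>_def field_simps)
    finally show ?thesis using e by linarith
  qed
  have "isCont (\<lambda>s. s powr \<beta>) 1" by (intro continuous_intros) auto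
  then obtain \<delta>0 where \<delta>0: "\<delta>0 > 0" "\<And>s. dist s 1 < \<delta>0 \<Longrightarrow> dist (s powr \<beta>) 1 < \<eta>"
    unfolding continuous_at_eps_delta using \<eta> by (metis powr_one_eq_one)
  define \<delta> where "\<delta> = min (\<delta>0 / 2) (1 / 2)"
  have \<delta>: "\<delta> > 0" "\<delta> < \<delta>0" "\<delta> < 1" using \<delta>0 by (auto simp: \<delta>_def)
  have near: "\<bar>s powr \<beta> - 1\<bar> \<le> \<eta>" if "s \<in> {1 - \<delta>..1 + \<delta>}" for s
  proof -
    have "dist s 1 < \<delta>0" using that \<delta> unfolding dist_real_def abs_less_iff by auto
    from \<delta>0(2)[OF this] show ?thesis by (simp add: dist_real_def)
  qed
  \<comment> \<open>Radius \<delta> / 2 around 1 - \<delta> / 2 and around 1 + \<delta> / 2: the two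
    windows meet exactly at 1. Since \<delta> < 1, the left one stays within the positive
    reals.\<close>
  have ends: "1 - \<delta> / 2 - \<delta> / 2 = 1 - \<delta>" "1 - \<delta> / 2 + \<delta> / 2 = 1" "1 + \<delta> / 2 - \<delta> / 2 = 1" "1 + \<delta> / 2 + \<delta> / 2 = 1 + \<delta>"
    by (auto simp: field_simps)
  note avg = tent_average[OF g g0 g_pos g_int B \<beta> B_pos lim]
  obtain Q c1 where Q: "(Q \<longlongrightarrow> c1) at_top" "\<bar>c1 - c\<bar> \<le> \<bar>c\<bar> * \<eta>"
    "\<And>l X. l > 0 \<Longrightarrow> B l > 0 \<Longrightarrow> (\<And>s. s \<in> {1 - \<delta>..1} \<Longrightarrow> g (l * s) \<le> X) \<Longrightarrow> Q l \<le> X / B l"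
    "\<And>l X. l > 0 \<Longrightarrow> B l > 0 \<Longrightarrow> (\<And>s. s \<in> {1 - \<delta>..1} \<Longrightarrow> X \<le> g (l * s)) \<Longrightarrow> X / B l \<le> Q l"
    by (rule avg[of "\<delta> / 2" "1 - \<delta> / 2" \<eta>, unfolded ends]) (use \<delta> near in auto)
  obtain R c2 where R: "(R \<longlongrightarrow> c2) at_top" "\<bar>c2 - c\<bar> \<le> \<bar>c\<bar> * \<eta>"
    "\<And>l X. l > 0 \<Longrightarrow> B l > 0 \<Longrightarrow> (\<And>s. s \<in> {1..1 + \<delta>} \<Longrightarrow> g (l * s) \<le> X) \<Longrightarrow> R l \<le> X / B l"
    "\<And>l X. l > 0 \<Longrightarrow> B l > 0 \<Longrightarrow> (\<And>s. s \<in> {1..1 + \<delta>} \<Longrightarrow> X \<le> g (l * s)) \<Longrightarrow> X / B l \<le> R l"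
    by (rule avg[of "\<delta> / 2" "1 + \<delta> / 2" \<eta>, unfolded ends]) (use \<delta> near in auto)
  have evQ: "\<forall>\<^sub>F l in at_top. \<bar>Q l - c\<bar> < e"
  proof -
    have "\<bar>c1 - c\<bar> < e" using Q(2) c\<eta> by linarith
    then show ?thesis by (intro order_tendstoD(2)[OF tendsto_rabs[OF tendsto_diff[OF Q(1) tendsto_const]]])
  qed
  have evR: "\<forall>\<^sub>F l in at_top. \<bar>R l - c\<bar> < e"
  proof -
    have "\<bar>c2 - c\<bar> < e" using R(2) c\<eta> by linarith
    then show ?thesis by (intro order_tendstoD(2)[OF tendsto_rabs[OF tendsto_diff[OF R(1) tendsto_const]]])
  qed
  show "\<forall>\<^sub>F t in at_top. dist (g t / B t) c < e"
    using evQ evR B_pos eventually_gt_at_top[of 0] eventually_ge_at_top[of "T / (1 - \<delta>)"]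
  proof eventually_elim
    case (elim l)
    \<comment> \<open>The threshold \<open>T / (1 - \<delta>)\<close> keeps the whole left window,
      scaled by l, in the range where g is monotone.\<close>
    have lT: "T \<le> l * (1 - \<delta>)" using elim(5) \<delta> by (simp add: field_simps)
    have lQ: "T \<le> l * s \<and> l * s \<le> l" if "s \<in> {1 - \<delta>..1}" for s
    proof -
      have "l * (1 - \<delta>) \<le> l * s" "l * s \<le> l * 1" using that elim(4) by (intro mult_left_mono; simp)+
      then show ?thesis using lT by linarith
    qed
    have lR: "l \<le> l * s" if "s \<in> {1..1 + \<delta>}" for s
      using that elim(4) mult_left_mono[of 1 s l] by simp
    have l: "T \<le> l" using lQ[of 1] \<delta> by simp
    from mono have "(Q l \<le> g l / B l \<and> g l / B l \<le> R l) \<or> (R l \<le> g l / B l \<and> g l / B l \<le> Q l)"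
    proof
      assume m: "mono_on {T..} g"
      have "Q l \<le> g l / B l"
        using mono_onD[OF m] lQ l elim by (intro Q(3)) auto
      moreover have "g l / B l \<le> R l"
      proof (rule R(4))
        fix s assume "s \<in> {1..1 + \<delta>}"
        then show "g l \<le> g (l * s)" using lR[of s] l by (intro mono_onD[OF m]) auto
      qed (use elim in auto)
      ultimately show ?thesis by simp
    next
      assume m: "antimono_on {T..} g"
      have "g l / B l \<le> Q l"
        using monotone_onD[OF m] lQ l elim by (intro Q(4)) auto
      moreover have "R l \<le> g l / B l"
      proof (rule R(3))
        fix s assume "s \<in> {1..1 + \<delta>}"
        then show "g (l * s) \<le> g l" using lR[of s] l by (intro monotone_onD[OF m]) auto
      qed (use elim in auto)
      ultimately show ?thesis by simp
    qed
    then show ?case using elim(1,2) unfolding dist_real_def by linarith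
  qed
qed

section \<open>Removing the sign condition from the Tauberian theorem\<close>

lemma monotone_eventually_signed:
  fixes g :: "real \<Rightarrow> real"
  assumes "mono_on {T..} g \<or> antimono_on {T..} g"
  obtains T' where "T' \<ge> T" "(\<forall>t\<ge>T'. g t \<ge> 0) \<or> (\<forall>t\<ge>T'. g t \<le> 0)"
proof (cases "(\<forall>t\<ge>T. g t \<ge> 0) \<or> (\<forall>t\<ge>T. g t \<le> 0)")
  case True
  then show ?thesis using that[of T] by simp
next
  case False
  then obtain a b where ab: "a \<ge> T" "b \<ge> T" "g a < 0" "g b > 0" by (auto simp: not_le)
  from assms show ?thesis
  proof
    assume m: "mono_on {T..} g"
    have "g t \<ge> 0" if "t \<ge> b" for t using mono_onD[OF m, of b t] that ab by auto
    then show ?thesis using ab that[of b] by simp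
  next
    assume m: "antimono_on {T..} g"
    have "g t \<le> 0" if "t \<ge> a" for t using monotone_onD[OF m, of a t] that ab by auto
    then show ?thesis using ab that[of a] by simp
  qed
qed

text \<open>Reduction to the nonnegative case. The part of g before T' has no controlled sign, but
  it vanishes eventually, so the Abelian theorem with constant 0 removes it from the transform. The
  signs \<sigma> of the tail of g and \<tau> of B are flipped independently, which changes c to
  \<sigma> * \<tau> * c.\<close>

lemma laplace_tauberian_monotone:
  fixes g B :: "real \<Rightarrow> real"
  assumes g[measurable]: "g \<in> borel_measurable lebesgue" and g0: "\<And>t. t < 0 \<Longrightarrow> g t = 0"
    and g_loc: "\<And>T. integrable lebesgue (\<lambda>t. indicator {..T} t * g t)"
    and g_int: "\<And>\<theta>. \<theta> > 0 \<Longrightarrow> integrable lebesgue (\<lambda>t. exp (- (\<theta> * t)) * g t)"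
    and B: "B \<in> RV_inf \<beta>" and \<beta>: "\<beta> > -1"
    and lim: "((\<lambda>l. laplace g (1 / l) / (l * B l)) \<longlongrightarrow> c * Gamma (\<beta> + 1)) at_top"
    and mono: "mono_on {T..} g \<or> antimono_on {T..} g"
  shows "((\<lambda>t. g t / B t) \<longlongrightarrow> c) at_top"
proof -
  obtain T' where T': "T' \<ge> T" "(\<forall>t\<ge>T'. g t \<ge> 0) \<or> (\<forall>t\<ge>T'. g t \<le> 0)"
    using monotone_eventually_signed[OF mono] by blast
  then obtain \<sigma> :: real where \<sigma>: "\<sigma> = 1 \<or> \<sigma> = -1" "\<And>t. t \<ge> T' \<Longrightarrow> \<sigma> * g t \<ge> 0"
    by (metis mult_minus1 mult_1 neg_0_le_iff_le)
  obtain \<tau> :: real where \<tau>: "\<tau> = 1 \<or> \<tau> = -1" "\<forall>\<^sub>F t in at_top. \<tau> * B t > 0"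
  proof -
    have "eventually_signed B" using B by (simp add: RV_inf_def)
    then show ?thesis unfolding eventually_signed_def using that[of 1] that[of "-1"] by auto
  qed
  have st: "\<sigma> \<noteq> 0" "\<tau> \<noteq> 0" "\<sigma> * \<sigma> = 1" "\<tau> * \<tau> = 1" using \<sigma>(1) \<tau>(1) by auto
  define g1 g2 where "g1 t = indicator {..<T'} t * g t" and "g2 t = \<sigma> * (indicator {T'..} t * g t)" for t
  have [measurable]: "g1 \<in> borel_measurable lebesgue" "g2 \<in> borel_measurable lebesgue"
    unfolding g1_def[abs_def] g2_def[abs_def] by measurable
  have g1_zero: "((\<lambda>t. g1 t / B t) \<longlongrightarrow> 0) at_top"
    by (rule tendsto_eventually) (use eventually_ge_at_top[of T'] in eventually_elim, simp add: g1_def)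
  have g1_loc: "integrable lebesgue (\<lambda>t. indicator {..S} t * g1 t)" for S
    by (rule Bochner_Integration.integrable_bound[OF g_loc[of S]])
       (measurable, auto simp: g1_def indicator_def intro!: AE_I2)
  have "((\<lambda>l. laplace g1 (1 / l) / (l * B l)) \<longlongrightarrow> 0 * Gamma (\<beta> + 1)) at_top"
    by (rule laplace_abelian(2)[OF _ _ g1_loc B \<beta> g1_zero]) (measurable, simp add: g1_def g0)
  then have lim1: "((\<lambda>l. laplace g1 (1 / l) / (l * B l)) \<longlongrightarrow> 0) at_top" by simp
  have int1: "integrable lebesgue (\<lambda>t. exp (- (\<theta> * t)) * g1 t)"
    and int2: "integrable lebesgue (\<lambda>t. exp (- (\<theta> * t)) * g2 t)" if "\<theta> > 0" for \<theta>
    by (rule Bochner_Integration.integrable_bound[OF g_int[OF that]];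
        use \<sigma>(1) in \<open>force simp: g1_def g2_def indicator_def intro!: AE_I2\<close>)+
  have g12: "g t = g1 t + \<sigma> * g2 t" for t
    using st by (auto simp: g1_def g2_def indicator_def mult.assoc[symmetric])
  have lap: "laplace g2 \<theta> = \<sigma> * (laplace g \<theta> - laplace g1 \<theta>)" if "\<theta> > 0" for \<theta>
  proof -
    have "laplace g \<theta> = (\<integral>t. exp (- (\<theta> * t)) * g1 t + \<sigma> * (exp (- (\<theta> * t)) * g2 t) \<partial>lebesgue)"
      unfolding laplace_def g12 by (simp add: algebra_simps)
    also have "\<dots> = laplace g1 \<theta> + \<sigma> * laplace g2 \<theta>"
      unfolding laplace_def using int1 int2 that by (subst Bochner_Integration.integral_add) auto
    finally show ?thesis using st by (simp add: mult.assoc[symmetric])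
  qed
  have "((\<lambda>t. g2 t / (\<tau> * B t)) \<longlongrightarrow> \<sigma> * \<tau> * c) at_top"
  proof (rule tauberian_monotone_nonneg)
    show "g2 t = 0" if "t < 0" for t using that by (simp add: g2_def g0)
    show "g2 t \<ge> 0" for t using \<sigma>(2)[of t] by (auto simp: g2_def indicator_def)
    show "integrable lebesgue (\<lambda>t. exp (- (\<theta> * t)) * g2 t)" if "\<theta> > 0" for \<theta> by (rule int2[OF that])
    show "(\<lambda>t. \<tau> * B t) \<in> RV_inf \<beta>" by (rule RV_inf_cmult[OF B st(2)])
    \<comment> \<open>Multiplication by \<sigma> = -1 exchanges the two alternatives, so only the
      disjunction is stable.\<close>
    show "mono_on {T'..} g2 \<or> antimono_on {T'..} g2"
      using mono \<sigma>(1) T'(1) by (fastforce simp: monotone_on_def g2_def)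
    have "((\<lambda>l. \<sigma> * \<tau> * (laplace g (1 / l) / (l * B l) - laplace g1 (1 / l) / (l * B l))) \<longlongrightarrow> \<sigma> * \<tau> * (c * Gamma (\<beta> + 1) - 0)) at_top"
      by (intro tendsto_intros lim lim1)
    then have "((\<lambda>l. \<sigma> * \<tau> * (laplace g (1 / l) / (l * B l) - laplace g1 (1 / l) / (l * B l))) \<longlongrightarrow> \<sigma> * \<tau> * c * Gamma (\<beta> + 1)) at_top"
      by (simp add: mult.assoc)
    then show "((\<lambda>l. laplace g2 (1 / l) / (l * (\<tau> * B l))) \<longlongrightarrow> \<sigma> * \<tau> * c * Gamma (\<beta> + 1)) at_top"
    proof (rule Lim_transform_eventually)
      show "\<forall>\<^sub>F l in at_top. \<sigma> * \<tau> * (laplace g (1 / l) / (l * B l) - laplace g1 (1 / l) / (l * B l)) = laplace g2 (1 / l) / (l * (\<tau> * B l))"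
        using eventually_gt_at_top[of 0] RV_infD(2)[OF B]
      proof eventually_elim
        case (elim l)
        show ?case using lap[of "1 / l"] elim \<tau>(1) by (auto simp: field_simps)
      qed
    qed
  qed (use \<beta> \<tau> in auto)
  from tendsto_mult[OF tendsto_const[of "\<sigma> * \<tau>"] this]
  have "((\<lambda>t. \<sigma> * \<tau> * (g2 t / (\<tau> * B t))) \<longlongrightarrow> c) at_top" using \<sigma>(1) \<tau>(1) by auto
  then show ?thesis
  proof (rule Lim_transform_eventually)
    show "\<forall>\<^sub>F t in at_top. \<sigma> * \<tau> * (g2 t / (\<tau> * B t)) = g t / B t"
      using eventually_ge_at_top[of T'] by eventually_elim (use \<sigma>(1) \<tau>(1) in \<open>auto simp: g2_def\<close>)
  qed
qed

section \<open>Transfer of second-order regular variation\<close>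

lemma RV_inf_powr_mult:
  assumes A: "A \<in> RV_inf \<rho>"
  shows "(\<lambda>t. t powr \<alpha> * A t) \<in> RV_inf (\<alpha> + \<rho>)"
proof -
  have "eventually_signed A" using A by (simp add: RV_inf_def)
  then have "eventually_signed (\<lambda>t. t powr \<alpha> * A t)"
    unfolding eventually_signed_def
  proof (elim disjE)
    assume "\<forall>\<^sub>F t in at_top. A t > 0"
    then have "\<forall>\<^sub>F t in at_top. t powr \<alpha> * A t > 0"
      using eventually_gt_at_top[of 0] by eventually_elim simp
    then show "(\<forall>\<^sub>F t in at_top. t powr \<alpha> * A t > 0) \<or> (\<forall>\<^sub>F t in at_top. t powr \<alpha> * A t < 0)" ..
  next
    assume "\<forall>\<^sub>F t in at_top. A t < 0"
    then have "\<forall>\<^sub>F t in at_top. t powr \<alpha> * A t < 0"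
      using eventually_gt_at_top[of 0] by eventually_elim (simp add: mult_less_0_iff)
    then show "(\<forall>\<^sub>F t in at_top. t powr \<alpha> * A t > 0) \<or> (\<forall>\<^sub>F t in at_top. t powr \<alpha> * A t < 0)" ..
  qed
  moreover have "(\<lambda>t::real. t powr \<alpha>) \<in> borel_measurable (lebesgue_on {0<..})"
    by (rule measurable_restrict_space1) measurable
  then have "(\<lambda>t. t powr \<alpha> * A t) \<in> borel_measurable (lebesgue_on {0<..})"
    by (intro borel_measurable_times RV_infD(3)[OF A])
  moreover have "((\<lambda>t. (t * x) powr \<alpha> * A (t * x) / (t powr \<alpha> * A t)) \<longlongrightarrow> x powr (\<alpha> + \<rho>)) at_top"
    if x: "x > 0" for x
  proof -
    have "((\<lambda>t. x powr \<alpha> * (A (t * x) / A t)) \<longlongrightarrow> x powr \<alpha> * x powr \<rho>) at_top"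
      by (intro tendsto_intros RV_infD(1)[OF A x])
    moreover have "\<forall>\<^sub>F t in at_top. x powr \<alpha> * (A (t * x) / A t) = (t * x) powr \<alpha> * A (t * x) / (t powr \<alpha> * A t)"
      using eventually_gt_at_top[of 0] by eventually_elim (use x in \<open>simp add: powr_mult\<close>)
    ultimately show ?thesis by (simp add: powr_add Lim_transform_eventually)
  qed
  ultimately show ?thesis unfolding RV_inf_def mem_Collect_eq by blast
qed

lemma RV_inf_powr: "(\<lambda>t. t powr \<alpha>) \<in> RV_inf \<alpha>"
proof -
  have "(\<lambda>_. 1) \<in> RV_inf 0"
    by (auto simp: RV_inf_def eventually_signed_def)
  from RV_inf_powr_mult[OF this, of \<alpha>] show ?thesis by simp
qed

lemma eventually_signed_powr_mult_limit:
  assumes "((\<lambda>t. t powr p * H t) \<longlongrightarrow> C) at_top" "C \<noteq> 0"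
  shows "eventually_signed H"
proof (cases "C > 0")
  case True
  then have "\<forall>\<^sub>F t in at_top. t powr p * H t > 0" by (rule order_tendstoD(1)[OF assms(1)])
  then have "\<forall>\<^sub>F t in at_top. H t > 0"
    using eventually_gt_at_top[of 0] by eventually_elim (simp add: zero_less_mult_iff)
  then show ?thesis by (simp add: eventually_signed_def)
next
  case False
  then have "C < 0" using assms(2) by simp
  then have "\<forall>\<^sub>F t in at_top. t powr p * H t < 0" by (rule order_tendstoD(2)[OF assms(1)])
  then have "\<forall>\<^sub>F t in at_top. H t < 0"
    using eventually_gt_at_top[of 0] by eventually_elim (simp add: mult_less_0_iff)
  then show ?thesis by (simp add: eventually_signed_def)
qed

text \<open>Membership of the transform in a class of regularly varying functions includes its
  measurability. Replacing g by a Borel function equal to it almost everywhere leaves all the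
  integrals unchanged and makes the integrand jointly measurable in \<theta> and t, as integration
  with a parameter requires.\<close>

lemma borel_measurable_laplace:
  assumes g: "g \<in> borel_measurable lebesgue"
  shows "laplace g \<in> borel_measurable borel"
proof -
  have "g \<in> borel_measurable (completion lborel)" using g by simp
  from completion_ex_borel_measurable_real[OF this] obtain f
    where f[measurable]: "f \<in> borel_measurable lborel" and AE: "AE t in lborel. g t = f t" by auto
  have AE': "AE t in lebesgue. g t = f t" using AE by (rule AE_completion)
  have "laplace g \<theta> = (\<integral>t. exp (- (\<theta> * t)) * f t \<partial>lborel)" for \<theta>
  proof -
    have "laplace g \<theta> = (\<integral>t. exp (- (\<theta> * t)) * f t \<partial>lebesgue)"
      unfolding laplace_def
    proof (rule integral_cong_AE)
      show "(\<lambda>t. exp (- (\<theta> * t)) * g t) \<in> borel_measurable lebesgue" using g by measurable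
      show "(\<lambda>t. exp (- (\<theta> * t)) * f t) \<in> borel_measurable lebesgue" by measurable
      show "AE t in lebesgue. exp (- (\<theta> * t)) * g t = exp (- (\<theta> * t)) * f t"
        using AE' by eventually_elim simp
    qed
    also have "\<dots> = (\<integral>t. exp (- (\<theta> * t)) * f t \<partial>lborel)" by (rule integral_completion) measurable
    finally show ?thesis .
  qed
  moreover have "(\<lambda>\<theta>. \<integral>t. exp (- (\<theta> * t)) * f t \<partial>lborel) \<in> borel_measurable borel"
    by (rule lborel.borel_measurable_lebesgue_integral) measurable
  ultimately show ?thesis by (simp add: measurable_cong[of borel "laplace g"])
qed

text \<open>The bridge between the definition and the expansion. It is applied twice, to F with A
  and to the transform with the rescaled A, so that everything else can be said about
  remainders.\<close>

lemma RV2_inf_iff_expansion: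
  assumes A: "A \<in> RV_inf_null \<rho>" and \<rho>: "\<rho> < 0" and F: "F \<in> borel_measurable (lebesgue_on {0<..})"
  shows "F \<in> RV2_inf \<alpha> \<rho> A \<longleftrightarrow>
    (\<exists>C. C \<noteq> 0 \<and> ((\<lambda>t. (t powr (-\<alpha>) * F t - C) / A t) \<longlongrightarrow> C / \<rho>) at_top)"
proof
  have AR: "A \<in> RV_inf \<rho>" "(A \<longlongrightarrow> 0) at_top" using A by (auto simp: RV_inf_null_def)
  note AD = RV_infD[OF AR(1)]
  {
    assume F2: "F \<in> RV2_inf \<alpha> \<rho> A"
    then have "F \<in> RV_inf \<alpha>" by (simp add: RV2_inf_def)
    note FD = RV_infD[OF this]
    have "((\<lambda>t. (F (t * x) / F t - x powr \<alpha>) / A t) \<longlongrightarrow> x powr \<alpha> * ((x powr \<rho> - 1) / \<rho>)) at_top" if "x > 0" for x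
      using F2 that \<rho> by (simp add: RV2_inf_def LBINT_powr_from_1)
    from second_order_expansion[OF FD(2) AD(2) AR(2) AD(1) \<rho> this]
    show "\<exists>C. C \<noteq> 0 \<and> ((\<lambda>t. (t powr (-\<alpha>) * F t - C) / A t) \<longlongrightarrow> C / \<rho>) at_top" by metis
  }
  assume "\<exists>C. C \<noteq> 0 \<and> ((\<lambda>t. (t powr (-\<alpha>) * F t - C) / A t) \<longlongrightarrow> C / \<rho>) at_top"
  then obtain C where C: "C \<noteq> 0" "((\<lambda>t. (t powr (-\<alpha>) * F t - C) / A t) \<longlongrightarrow> C / \<rho>) at_top" by blast
  note so = second_order_of_expansion[OF C AD(2) AR(2) AD(1) \<rho>]
  have "F \<in> RV_inf \<alpha>"
    using F so(2) eventually_signed_powr_mult_limit[OF so(1) C(1)] by (simp add: RV_inf_def)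
  moreover have "eventually_signed A" using AR(1) by (simp add: RV_inf_def)
  ultimately show "F \<in> RV2_inf \<alpha> \<rho> A"
    using so(3) \<rho> by (simp add: RV2_inf_def LBINT_powr_from_1)
qed

theorem theorem4p1:
  fixes F A :: "real \<Rightarrow> real" and \<alpha> \<rho> :: real
  assumes F_measurable: "F \<in> borel_measurable (lebesgue_on {0..})"
    and F_pos: "\<And>t. t \<ge> 0 \<Longrightarrow> F t > 0"
    and F_locally_bounded: "locally_bounded_on {0..} F"
    and alpha: "\<alpha> > -1"
    and rho: "\<rho> \<in> {-1 - \<alpha><..<0}"
    and A: "A \<in> RV_inf_null \<rho>"
  shows "(F \<in> RV2_inf \<alpha> \<rho> A \<longrightarrow>
           (\<lambda>l. LS_transform F (1 / l))
             \<in> RV2_inf \<alpha> \<rho> (\<lambda>t. Gamma (\<alpha> + \<rho> + 1) / Gamma (\<alpha> + 1) * A t)) \<and>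
         (F \<in> M_inf_minus \<alpha> \<and>
           (\<lambda>l. LS_transform F (1 / l))
             \<in> RV2_inf \<alpha> \<rho> (\<lambda>t. Gamma (\<alpha> + \<rho> + 1) / Gamma (\<alpha> + 1) * A t) \<longrightarrow>
           F \<in> RV2_inf \<alpha> \<rho> A)"
proof -
  define G1 G2 k where "G1 = Gamma (\<alpha> + 1)" and "G2 = Gamma (\<alpha> + \<rho> + 1)" and "k = G2 / G1"
  have G: "G1 > 0" "G2 > 0" unfolding G1_def G2_def using alpha rho by (auto intro!: Gamma_real_pos)
  have k: "k > 0" using G by (simp add: k_def)
  define H where "H l = LS_transform F (1 / l)" for l
  define B where "B t = t powr \<alpha> * A t" for t
  have \<rho>: "\<rho> < 0" using rho by simp
  have \<beta>: "\<alpha> + \<rho> > -1" using rho by simp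
  have AR: "A \<in> RV_inf \<rho>" using A by (simp add: RV_inf_null_def)
  have BR: "B \<in> RV_inf (\<alpha> + \<rho>)" unfolding B_def[abs_def] by (rule RV_inf_powr_mult[OF AR])
  have kA: "(\<lambda>t. k * A t) \<in> RV_inf_null \<rho>"
    using A RV_inf_cmult[OF AR, of k] k by (auto simp: RV_inf_null_def intro!: tendsto_mult_right_zero)
  define f w where "f t = indicator {0..} t * F t" and "w t = indicator {0..} t * t powr \<alpha>" for t
  have "(\<lambda>t. indicator {0..} t *\<^sub>R F t) \<in> borel_measurable lebesgue"
    using F_measurable by (subst (asm) borel_measurable_restrict_space_iff) auto
  then have f_meas[measurable]: "f \<in> borel_measurable lebesgue" by (simp add: f_def[abs_def])
  have w_meas[measurable]: "w \<in> borel_measurable lebesgue" unfolding w_def[abs_def] by measurable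
  have F_meas: "F \<in> borel_measurable (lebesgue_on {0<..})"
    using F_measurable by (rule measurable_restrict_mono) auto
  have f_loc: "integrable lebesgue (\<lambda>t. indicator {..T} t * f t)" for T
  proof -
    have "bounded (F ` {0..T})" using F_locally_bounded by (auto simp: locally_bounded_on_def)
    then obtain M where "\<forall>y\<in>F ` {0..T}. norm y \<le> M" unfolding bounded_iff by blast
    then have M: "\<bar>F t\<bar> \<le> M" if "t \<in> {0..T}" for t using that by auto
    show ?thesis
    proof (rule Bochner_Integration.integrable_bound)
      show "integrable lebesgue (\<lambda>t. M * indicator {0..T} t)"
        by (intro integrable_mult_right integrable_real_indicator) (auto simp: emeasure_lborel_Icc_eq)
      show "AE t in lebesgue. norm (indicator {..T} t * f t) \<le> norm (M * indicator {0..T} t)"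
        using M by (intro AE_I2) (fastforce simp: f_def indicator_def)
    qed measurable
  qed
  have w_int: "integrable lebesgue (\<lambda>t. exp (- (\<theta> * t)) * w t)"
    and w_lap: "laplace w \<theta> = G1 * \<theta> powr (- \<alpha> - 1)" if "\<theta> > 0" for \<theta>
    using has_bochner_integral_exp_powr[OF alpha that] by (auto simp: laplace_def w_def G1_def has_bochner_integral_iff)
  have w_loc: "integrable lebesgue (\<lambda>t. indicator {..T} t * w t)" for T
  proof (rule Bochner_Integration.integrable_bound)
    \<comment> \<open>For t up to T the factor \<open>exp (T - t)\<close> is at least 1, so the
      exponentially weighted integral dominates the truncated one, including the singularity at 0
      when \<alpha> < 0.\<close>
    show "integrable lebesgue (\<lambda>t. exp T * (exp (- (1 * t)) * w t))" by (intro integrable_mult_right w_int) simp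
    show "AE t in lebesgue. norm (indicator {..T} t * w t) \<le> norm (exp T * (exp (- (1 * t)) * w t))"
    proof (rule AE_I2)
      fix t
      have "\<bar>w t\<bar> \<le> exp (T - t) * \<bar>w t\<bar>" if "t \<le> T"
        using that mult_right_mono[of 1 "exp (T - t)" "\<bar>w t\<bar>"] by simp
      then show "norm (indicator {..T} t * w t) \<le> norm (exp T * (exp (- (1 * t)) * w t))"
        by (auto simp: indicator_def abs_mult mult.assoc[symmetric] exp_diff exp_minus divide_inverse)
    qed
  qed measurable
  have H_eq: "H l = laplace f (1 / l) / l" for l
    by (simp add: H_def LS_transform_eq_laplace f_def[abs_def])
  have H_meas: "H \<in> borel_measurable (lebesgue_on {0<..})"
  proof -
    note [measurable] = borel_measurable_laplace[OF f_meas]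
    have "H \<in> borel_measurable borel" unfolding H_eq[abs_def] by measurable
    then show ?thesis by (intro measurable_restrict_space1 borel_measurable_lebesgueI)
  qed
  \<comment> \<open>The remainder for a candidate constant C. It stays a parameter because the
    expansion of F asserts that some C works, while the second implication prescribes C through the
    monotonicity class.\<close>
  define g where "g C t = f t - C * w t" for C t
  have g_meas[measurable]: "g C \<in> borel_measurable lebesgue" for C unfolding g_def[abs_def] by measurable
  have g0: "g C t = 0" if "t < 0" for C t using that by (simp add: g_def f_def w_def)
  have g_loc: "integrable lebesgue (\<lambda>t. indicator {..T} t * g C t)" for C T
  proof -
    have "(\<lambda>t. indicator {..T} t * g C t) = (\<lambda>t. indicator {..T} t * f t - C * (indicator {..T} t * w t))"
      by (simp add: g_def algebra_simps)
    then show ?thesis using f_loc w_loc by simp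
  qed
  have g_B: "\<forall>\<^sub>F t in at_top. (t powr (-\<alpha>) * F t - C) / A t = g C t / B t" for C
    using eventually_gt_at_top[of 0] RV_infD(2)[OF AR]
    by eventually_elim (simp add: g_def B_def f_def w_def powr_minus field_simps)
  have F_iff: "F \<in> RV2_inf \<alpha> \<rho> A \<longleftrightarrow> (\<exists>C. C \<noteq> 0 \<and> ((\<lambda>t. g C t / B t) \<longlongrightarrow> C / \<rho>) at_top)"
    unfolding RV2_inf_iff_expansion[OF A \<rho> F_meas] using tendsto_cong[OF g_B] by simp
  \<comment> \<open>Linearity of the integral needs \<open>f\<close> to be integrable against the
    exponentials. In one direction this follows from the estimate for the remainder, in the other
    from the Abelian theorem for \<open>f\<close> against \<open>t powr \<alpha>\<close>, hence the
    premise.\<close>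
  have g_lap: "\<forall>\<^sub>F l in at_top. (l powr (-\<alpha>) * H l - C * G1) / (k * A l) = laplace (g C) (1 / l) / (l * B l) / k"
    if int: "\<And>\<theta>. \<theta> > 0 \<Longrightarrow> integrable lebesgue (\<lambda>t. exp (- (\<theta> * t)) * f t)" for C
    using eventually_gt_at_top[of 0] RV_infD(2)[OF AR]
  proof eventually_elim
    case (elim l)
    have "laplace (g C) (1 / l) = (\<integral>t. exp (- (1 / l * t)) * f t - C * (exp (- (1 / l * t)) * w t) \<partial>lebesgue)"
      unfolding laplace_def g_def by (simp add: algebra_simps)
    also have "\<dots> = laplace f (1 / l) - C * laplace w (1 / l)"
      unfolding laplace_def using int[of "1 / l"] w_int[of "1 / l"] elim
      by (subst Bochner_Integration.integral_diff) auto
    also have "laplace w (1 / l) = G1 * (l powr \<alpha> * l)"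
      using elim by (simp add: w_lap powr_divide powr_diff powr_minus field_simps)
    finally have *: "laplace (g C) (1 / l) = laplace f (1 / l) - C * (G1 * (l powr \<alpha> * l))" .
    show ?case unfolding * H_eq B_def using elim k by (simp add: powr_minus field_simps)
  qed
  have part1: "H \<in> RV2_inf \<alpha> \<rho> (\<lambda>t. k * A t)" if F2: "F \<in> RV2_inf \<alpha> \<rho> A"
  proof -
    obtain C where C: "C \<noteq> 0" "((\<lambda>t. g C t / B t) \<longlongrightarrow> C / \<rho>) at_top" using F2 F_iff by blast
    note ab = laplace_abelian[OF g_meas g0 g_loc BR \<beta> C(2)]
    have f_int: "integrable lebesgue (\<lambda>t. exp (- (\<theta> * t)) * f t)" if "\<theta> > 0" for \<theta>
    proof -
      have "(\<lambda>t. exp (- (\<theta> * t)) * f t) = (\<lambda>t. exp (- (\<theta> * t)) * g C t + C * (exp (- (\<theta> * t)) * w t))"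
        by (simp add: g_def algebra_simps)
      then show ?thesis using ab(1)[of \<theta>] that w_int[OF that] by simp
    qed
    have "((\<lambda>l. laplace (g C) (1 / l) / (l * B l) / k) \<longlongrightarrow> C / \<rho> * G2 / k) at_top"
      unfolding G2_def using k by (intro tendsto_divide ab(2) tendsto_const) auto
    then have "((\<lambda>l. (l powr (-\<alpha>) * H l - C * G1) / (k * A l)) \<longlongrightarrow> C / \<rho> * G2 / k) at_top"
      using tendsto_cong[OF g_lap[OF f_int]] by simp
    \<comment> \<open>This identity determines k: the second-order coefficient must be the new
      leading constant \<open>C * G1\<close> divided by \<rho>.\<close>
    moreover have "C / \<rho> * G2 / k = C * G1 / \<rho>" using G by (simp add: k_def)
    moreover have "C * G1 \<noteq> 0" using C G by simp
    ultimately show ?thesis unfolding RV2_inf_iff_expansion[OF kA \<rho> H_meas] by metis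
  qed
  have part2: "F \<in> RV2_inf \<alpha> \<rho> A" if FM: "F \<in> M_inf_minus \<alpha>" and H2: "H \<in> RV2_inf \<alpha> \<rho> (\<lambda>t. k * A t)"
  proof -
    obtain C where C: "C \<noteq> 0" "((\<lambda>t. t powr (-\<alpha>) * F t) \<longlongrightarrow> C) at_top"
      "eventually_monotone (\<lambda>t. F t - C * t powr \<alpha>)"
      using FM by (auto simp: M_inf_minus_def)
    have "\<forall>\<^sub>F t in at_top. t powr (-\<alpha>) * F t = f t / t powr \<alpha>"
      using eventually_gt_at_top[of 0] by eventually_elim (simp add: f_def powr_minus field_simps)
    then have "((\<lambda>t. f t / t powr \<alpha>) \<longlongrightarrow> C) at_top" using C(2) by (rule Lim_transform_eventually[rotated])
    note ab = laplace_abelian[OF f_meas _ f_loc RV_inf_powr alpha this]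
    have f_neg: "f t = 0" if "t < 0" for t using that by (simp add: f_def)
    have f_int: "integrable lebesgue (\<lambda>t. exp (- (\<theta> * t)) * f t)" if "\<theta> > 0" for \<theta>
      using ab(1) f_neg that by blast
    have "((\<lambda>l. laplace f (1 / l) / (l * l powr \<alpha>)) \<longlongrightarrow> C * G1) at_top"
      unfolding G1_def using ab(2) f_neg by blast
    moreover have "\<forall>\<^sub>F l in at_top. laplace f (1 / l) / (l * l powr \<alpha>) = l powr (-\<alpha>) * H l"
      using eventually_gt_at_top[of 0] by eventually_elim (simp add: H_eq powr_minus field_simps)
    ultimately have H_lim: "((\<lambda>l. l powr (-\<alpha>) * H l) \<longlongrightarrow> C * G1) at_top"
      by (rule Lim_transform_eventually)
    \<comment> \<open>Both C' and \<open>C * G1\<close> are limits of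
      \<open>l powr (-\<alpha>) * H l\<close>, hence equal. So the remainder whose transform is
      known is the very one that is eventually monotone.\<close>
    obtain C' where C': "C' \<noteq> 0" "((\<lambda>l. (l powr (-\<alpha>) * H l - C') / (k * A l)) \<longlongrightarrow> C' / \<rho>) at_top"
      using H2 unfolding RV2_inf_iff_expansion[OF kA \<rho> H_meas] by blast
    have kAR: "(\<lambda>t. k * A t) \<in> RV_inf \<rho>" "((\<lambda>t. k * A t) \<longlongrightarrow> 0) at_top" using kA by (auto simp: RV_inf_null_def)
    note kAD = RV_infD[OF kAR(1)]
    have "((\<lambda>l. l powr (-\<alpha>) * H l) \<longlongrightarrow> C') at_top"
      by (rule second_order_of_expansion(1)[OF C' kAD(2) kAR(2) kAD(1) \<rho>])
    then have C'_eq: "C' = C * G1" using H_lim by (intro tendsto_unique[OF trivial_limit_at_top_linorder])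
    have g_int: "integrable lebesgue (\<lambda>t. exp (- (\<theta> * t)) * g C t)" if "\<theta> > 0" for \<theta>
    proof -
      have "(\<lambda>t. exp (- (\<theta> * t)) * g C t) = (\<lambda>t. exp (- (\<theta> * t)) * f t - C * (exp (- (\<theta> * t)) * w t))"
        by (simp add: g_def algebra_simps)
      then show ?thesis using f_int[OF that] w_int[OF that] by simp
    qed
    have "((\<lambda>l. laplace (g C) (1 / l) / (l * B l) / k) \<longlongrightarrow> C * G1 / \<rho>) at_top"
      using C'(2) unfolding C'_eq using tendsto_cong[OF g_lap[OF f_int, of C]] by simp
    then have *: "((\<lambda>l. laplace (g C) (1 / l) / (l * B l) / k * k) \<longlongrightarrow> C * G1 / \<rho> * k) at_top"
      by (intro tendsto_mult tendsto_const)
    have eq: "C * G1 / \<rho> * k = C / \<rho> * Gamma (\<alpha> + \<rho> + 1)" using G by (simp add: k_def G2_def)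
    have lap_lim: "((\<lambda>l. laplace (g C) (1 / l) / (l * B l)) \<longlongrightarrow> C / \<rho> * Gamma (\<alpha> + \<rho> + 1)) at_top"
      using * k unfolding eq by simp
    obtain T where T: "mono_on {T..} (\<lambda>t. F t - C * t powr \<alpha>) \<or> antimono_on {T..} (\<lambda>t. F t - C * t powr \<alpha>)"
      using C(3) by (auto simp: eventually_monotone_def)
    \<comment> \<open>The extension by zero agrees with \<open>F t - C * t powr \<alpha>\<close>
      only for t \<ge> 0, and T may be negative.\<close>
    have "mono_on {max T 0..} (g C) \<or> antimono_on {max T 0..} (g C)"
      using T by (auto simp: monotone_on_def g_def f_def w_def)
    from laplace_tauberian_monotone[OF g_meas g0 g_loc g_int BR \<beta> lap_lim this]
    show ?thesis using C(1) F_iff by blast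
  qed
  show ?thesis
    using part1 part2 unfolding H_def[abs_def] k_def G1_def G2_def by blast
qed

end
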